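(* Let $n \geq 4$. Among all trees on $n$ vertices with diameter $3$, the meeting time $T_{\mathsf{meet}}(G)$ is minimized uniquely (up to isomorphism) by the balanced double star $D_{n,3}$. When $n$ is even, $$T_{\mathsf{meet}}(D_{n,3}) = H(\pi, v_0) = \frac{5}{2}n - 4 - \frac{1}{2(n-1)},$$ and when $n$ is odd, $$T_{\mathsf{meet}}(D_{n,3}) = H(\pi, v_0) = \frac{5}{2}n - 3,$$ where $v_0$ is a leaf adjacent to $v_1$.
   Context: For a connected graph $G=(V,E)$ and simple random walk on $G$ (each step moves to a uniformly random neighbor), $H(u,v)$ denotes the expected number of steps for the walk from $u$ to reach $v$ ($H(u,u)=0$), $\pi_v=\deg(v)/2|E|$ is the stationary distribution, $H(\pi,w)=\sum_{v}\pi_v H(v,w)$, and $T_{\mathsf{meet}}(G)=\max_{w\in V}H(\pi,w)$. A tree of diameter $3$ on $n$ vertices (a double star) consists of an edge $v_1v_2$, $\ell\ge 1$ leaves adjacent to $v_1$ and $r\ge1$ leaves adjacent to $v_2$, with $\ell+r=n-2$. The balanced double star $D_{n,3}$ has $\ell=\lfloor (n-2)/2\rfloor$ and $r=\lceil (n-2)/2\rceil$. *)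

theory Defs
  imports "HOL-Probability.Probability" "Graph_Theory.Graph_Theory"
begin

text \<open>
  A finite simple graph is a \<open>pair_graph\<close>: a finite, loop-free, symmetric digraph whose arcs are
  pairs of vertices, so that every undirected edge is represented by two opposite arcs.
\<close>

text \<open>
  \<open>Digraph_Component.tree\<close> is not usable for symmetric digraphs, where \<open>u, v, u\<close> counts as a
  directed cycle. Cycles of a simple graph are the directed cycles of length at least 3.
\<close>

definition is_tree :: "'a pair_pre_digraph \<Rightarrow> bool" where
  "is_tree G \<longleftrightarrow> pair_graph G \<and> Digraph_Component.connected (with_proj G) \<and>
     \<not> (\<exists>p. pre_digraph.cycle (with_proj G) p \<and> length p \<ge> 3)"

definition graph_dist :: "'a pair_pre_digraph \<Rightarrow> 'a \<Rightarrow> 'a \<Rightarrow> ereal" where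
  "graph_dist G u v = wf_digraph.\<mu> (with_proj G) (\<lambda>_. 1) u v"

definition graph_diameter :: "'a pair_pre_digraph \<Rightarrow> ereal" where
  "graph_diameter G = (SUP u\<in>pverts G. SUP v\<in>pverts G. graph_dist G u v)"

definition neighbours :: "'a pair_pre_digraph \<Rightarrow> 'a \<Rightarrow> 'a set" where
  "neighbours G u = {v. (u, v) \<in> parcs G}"

definition vertex_degree :: "'a pair_pre_digraph \<Rightarrow> 'a \<Rightarrow> nat" where
  "vertex_degree G v = card (neighbours G v)"

text \<open>
  Simple random walk started at \<open>u\<close>: conditionally on the first \<open>i\<close> positions (stored in \<open>\<omega>\<close>),
  the law of position \<open>i\<close> is the point mass at \<open>u\<close> for \<open>i = 0\<close>, and uniform on the neighbours of
  the previous position otherwise. The law of the trajectory on \<open>nat \<Rightarrow> 'a\<close> is the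
  Ionescu-Tulcea projective limit of these kernels.
\<close>

definition srw_kernel ::
    "'a pair_pre_digraph \<Rightarrow> 'a \<Rightarrow> nat \<Rightarrow> (nat \<Rightarrow> 'a) \<Rightarrow> 'a measure" where
  "srw_kernel G u i \<omega> =
     (if i = 0 then return (count_space UNIV) u
      else measure_pmf (pmf_of_set (neighbours G (\<omega> (i - 1)))))"

lemma Ionescu_Tulcea_srw:
  fixes G :: "'a pair_pre_digraph"
  shows "Ionescu_Tulcea (srw_kernel G u) (\<lambda>_. count_space UNIV)"
proof (rule Ionescu_Tulcea.intro)
  fix i
  show "srw_kernel G u i \<in> measurable (PiM {0..<i} (\<lambda>_. count_space UNIV))
          (subprob_algebra (count_space UNIV))"
  proof (cases "i = 0")
    case True
    then show ?thesis
      by (auto simp: srw_kernel_def[abs_def] space_subprob_algebra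
               intro!: measurable_const prob_space_imp_subprob_space prob_space_return)
  next
    case False
    have "(\<lambda>\<omega>. \<omega> (i - 1)) \<in> measurable (PiM {0..<i} (\<lambda>_. count_space UNIV)) (count_space UNIV)"
      using False by (intro measurable_component_singleton) auto
    moreover have "(\<lambda>x. measure_pmf (pmf_of_set (neighbours G x)))
        \<in> measurable (count_space UNIV) (subprob_algebra (count_space UNIV))"
      by (auto simp: space_subprob_algebra
               intro!: prob_space_imp_subprob_space measure_pmf.prob_space_axioms)
    ultimately show ?thesis
      using False by (auto simp: srw_kernel_def[abs_def] intro: measurable_compose)
  qed
next
  fix i :: nat and \<omega> :: "nat \<Rightarrow> 'a"
  show "prob_space (srw_kernel G u i \<omega>)"
    by (auto simp: srw_kernel_def intro!: prob_space_return measure_pmf.prob_space_axioms)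
qed

definition srw :: "'a pair_pre_digraph \<Rightarrow> 'a \<Rightarrow> (nat \<Rightarrow> 'a) measure" where
  "srw G u = projective_family.lim UNIV
     (Ionescu_Tulcea.CI (srw_kernel G u) (\<lambda>_. count_space UNIV)) (\<lambda>_. count_space UNIV)"

text \<open>The first time a trajectory is at \<open>v\<close>; this is \<open>\<infinity>\<close> if it never visits \<open>v\<close>.\<close>

definition first_hit :: "'a \<Rightarrow> (nat \<Rightarrow> 'a) \<Rightarrow> ennreal" where
  "first_hit v \<omega> = (INF t\<in>{t. \<omega> t = v}. of_nat t)"

definition hitting_time :: "'a pair_pre_digraph \<Rightarrow> 'a \<Rightarrow> 'a \<Rightarrow> ennreal" where
  "hitting_time G u v = (\<integral>\<^sup>+ \<omega>. first_hit v \<omega> \<partial>srw G u)"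

text \<open>\<open>parcs G\<close> contains both orientations of every edge, so its cardinality is \<open>2|E|\<close>.\<close>

definition stationary :: "'a pair_pre_digraph \<Rightarrow> 'a \<Rightarrow> real" where
  "stationary G v = real (vertex_degree G v) / real (card (parcs G))"

definition stationary_hitting_time :: "'a pair_pre_digraph \<Rightarrow> 'a \<Rightarrow> ennreal" where
  "stationary_hitting_time G w =
     (\<Sum>v\<in>pverts G. ennreal (stationary G v) * hitting_time G v w)"

definition T_meet :: "'a pair_pre_digraph \<Rightarrow> ennreal" where
  "T_meet G = (MAX w\<in>pverts G. stationary_hitting_time G w)"

text \<open>
  The double star with centres \<open>v\<^sub>1 = 0\<close> and \<open>v\<^sub>2 = 1\<close>; the \<open>l\<close> leaves at \<open>v\<^sub>1\<close> are
  \<open>2, \<dots>, l + 1\<close>, and the \<open>r\<close> leaves at \<open>v\<^sub>2\<close> are \<open>l + 2, \<dots>, l + r + 1\<close>.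
\<close>

definition double_star :: "nat \<Rightarrow> nat \<Rightarrow> nat pair_pre_digraph" where
  "double_star l r =
     (let A = {(0, 1)} \<union> {0} \<times> {2..<l + 2} \<union> {1} \<times> {l + 2..<l + r + 2}
      in \<lparr>pverts = {0..<l + r + 2}, parcs = A \<union> A\<inverse>\<rparr>)"

definition balanced_double_star :: "nat \<Rightarrow> nat pair_pre_digraph" where
  "balanced_double_star n =
     double_star (nat \<lfloor>(real n - 2) / 2\<rfloor>) (nat \<lceil>(real n - 2) / 2\<rceil>)"

end

theory Submission
  imports Defs
begin

text \<open>
  If a nonnegative function \<open>g\<close> vanishes at \<open>v\<close> and equals 1 plus its average over the neighbours
  everywhere else, then adding the elapsed time to \<open>g\<close> gives a martingale up to the time \<open>v\<close> is
  hit, and optional stopping identifies \<open>g\<close> with the expected hitting time of \<open>v\<close>. On a double star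
  such functions can be written down explicitly. The maximum of \<open>H(\<pi>, w)\<close> is attained at a leaf \<open>w\<close>,
  where its value depends only on \<open>n\<close> and, strictly increasingly, on the number of leaves at the other
  centre. Hence the meeting time is a strictly increasing function of \<open>max(\<ell>, r)\<close>.

  A tree of diameter 3 contains a path \<open>u, a, b, v\<close> whose end points are at distance 3. A vertex not
  adjacent to \<open>a\<close> or \<open>b\<close> would extend it to a path of length 4, whose ends must be joined by a walk
  of length at most 3, which closes a cycle; so the tree is a double star with centres \<open>a\<close> and \<open>b\<close>.
\<close>

section \<open>Hitting times of simple random walk\<close>

context Ionescu_Tulcea begin

text \<open>The limit measure is characterised by its values on cylinders, and \<open>C 0 n\<close>
  supplies the value on a cylinder over the first \<open>n\<close> coordinates. It starts from the
  empty history, which is represented by the constant function \<open>undefined\<close>.\<close>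

lemma distr_lim_restrict:
  "distr PF.lim (PiM {0..<n} M) (\<lambda>\<omega>. restrict \<omega> {0..<n}) = C 0 n (\<lambda>_. undefined)"
proof (rule measure_eqI)
  have sp: "(\<lambda>_. undefined) \<in> space (PiM {0..<0} M)"
    by (simp add: space_PiM)
  show "sets (distr PF.lim (PiM {0..<n} M) (\<lambda>\<omega>. restrict \<omega> {0..<n})) = sets (C 0 n (\<lambda>_. undefined))"
    using sets_C[OF sp, of n] by simp
  fix A assume "A \<in> sets (distr PF.lim (PiM {0..<n} M) (\<lambda>\<omega>. restrict \<omega> {0..<n}))"
  then have A: "A \<in> sets (PiM {0..<n} M)" by simp
  have "emeasure (distr PF.lim (PiM {0..<n} M) (\<lambda>\<omega>. restrict \<omega> {0..<n})) A
      = emeasure PF.lim (PF.emb UNIV {0..<n} A)"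
    using A by (intro emeasure_distr_restrict) auto
  also have "\<dots> = C 0 n (\<lambda>_. undefined) (PF.emb {0..<n} {0..<n} A)"
    using A by (simp add: lim emeasure_CI[of _ n])
  also have "PF.emb {0..<n} {0..<n} A = A"
    using A sets.sets_into_space[OF A] by (intro prod_emb_id) (auto simp: space_PiM)
  finally show "emeasure (distr PF.lim (PiM {0..<n} M) (\<lambda>\<omega>. restrict \<omega> {0..<n})) A
      = emeasure (C 0 n (\<lambda>_. undefined)) A" .
qed

lemma nn_integral_lim_restrict:
  assumes f: "f \<in> borel_measurable (PiM {0..<n} M)"
  shows "(\<integral>\<^sup>+\<omega>. f (restrict \<omega> {0..<n}) \<partial>PF.lim) = (\<integral>\<^sup>+\<omega>. f \<omega> \<partial>C 0 n (\<lambda>_. undefined))"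
proof -
  have "(\<lambda>\<omega>. restrict \<omega> {0..<n}) \<in> measurable PF.lim (PiM {0..<n} M)"
    using measurable_restrict_subset[of "{0..<n}" UNIV M] by (simp cong: measurable_cong_sets)
  then show ?thesis
    unfolding distr_lim_restrict[symmetric] using f by (simp add: nn_integral_distr)
qed

text \<open>Tower rule: \<open>C 0 (Suc n)\<close> is the bind of \<open>C 0 n\<close> with
  \<open>eP n\<close>, which appends one coordinate drawn from \<open>P n\<close>. The newest
  coordinate can therefore be integrated out first, given the history.\<close>

lemma nn_integral_lim_Suc:
  assumes f: "f \<in> borel_measurable (PiM {0..<Suc n} M)"
  shows "(\<integral>\<^sup>+\<omega>. f (restrict \<omega> {0..<Suc n}) \<partial>PF.lim)
       = (\<integral>\<^sup>+\<omega>. (\<integral>\<^sup>+x. f (fun_upd (restrict \<omega> {0..<n}) n x) \<partial>P n (restrict \<omega> {0..<n})) \<partial>PF.lim)"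
proof -
  have sp: "(\<lambda>_. undefined) \<in> space (PiM {0..<0} M)"
    by (simp add: space_PiM)
  have m: "(\<lambda>\<omega>. \<integral>\<^sup>+x. f x \<partial>eP n \<omega>) \<in> borel_measurable (PiM {0..<n} M)"
    using measurable_compose[OF measurable_eP nn_integral_measurable_subprob_algebra[OF f]] .
  have "(\<integral>\<^sup>+\<omega>. f (restrict \<omega> {0..<Suc n}) \<partial>PF.lim) = (\<integral>\<^sup>+\<omega>. f \<omega> \<partial>C 0 (Suc n) (\<lambda>_. undefined))"
    using f by (rule nn_integral_lim_restrict)
  also have "\<dots> = (\<integral>\<^sup>+\<omega>. \<integral>\<^sup>+x. f x \<partial>eP n \<omega> \<partial>C 0 n (\<lambda>_. undefined))"
  proof -
    have "eP n \<in> measurable (C 0 n (\<lambda>_. undefined)) (subprob_algebra (PiM {0..<Suc n} M))"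
      using sets_C[OF sp, of n] by (simp cong: measurable_cong_sets)
    then show ?thesis using f by (simp add: nn_integral_bind)
  qed
  also have "\<dots> = (\<integral>\<^sup>+\<omega>. (\<integral>\<^sup>+x. f x \<partial>eP n (restrict \<omega> {0..<n})) \<partial>PF.lim)"
    using m by (rule nn_integral_lim_restrict[symmetric])
  also have "\<dots> = (\<integral>\<^sup>+\<omega>. (\<integral>\<^sup>+x. f (fun_upd (restrict \<omega> {0..<n}) n x) \<partial>P n (restrict \<omega> {0..<n})) \<partial>PF.lim)"
    using f by (intro nn_integral_cong nn_integral_eP) (auto simp: space_PiM PiE_iff)
  finally show ?thesis .
qed

lemma prob_space_lim: "prob_space PF.lim"
proof
  \<comment> \<open>The cylinder over no coordinates is the whole space, so the total mass is that
    of the marginal on the empty index set.\<close>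
  have e: "PF.emb UNIV {} (space (PiM {} M)) = space (PiM UNIV M)"
    by (auto simp: prod_emb_def space_PiM)
  show "emeasure PF.lim (space PF.lim) = 1"
    using lim[of "{}" "space (PiM {} M)"] prob_space.emeasure_space_1[OF PF.prob_space_P[of "{}"]]
    by (simp add: e PF.space_P)
qed

end

section \<open>The walk observed until it leaves a set, and its Markov property\<close>

lemma borel_measurable_stopped_PiM:
  fixes f :: "'a \<Rightarrow> ennreal" and t :: nat
  assumes "{..t} \<subseteq> J" "n \<in> J"
  shows "(\<lambda>\<omega>. if \<forall>s\<le>t. \<omega> s \<in> S then f (\<omega> n) else 0)
    \<in> borel_measurable (PiM J (\<lambda>_. count_space UNIV))"
proof (intro measurable_If)
  have c: "(\<lambda>\<omega>. \<omega> s) \<in> measurable (PiM J (\<lambda>_. count_space UNIV)) (count_space UNIV)"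
    if "s \<in> J" for s
    using that by (intro measurable_component_singleton) auto
  show "(\<lambda>\<omega>. f (\<omega> n)) \<in> borel_measurable (PiM J (\<lambda>_. count_space UNIV))"
    using c[OF assms(2)] by (rule measurable_compose) auto
  have "{\<omega> \<in> space (PiM J (\<lambda>_. count_space UNIV)). \<forall>s\<in>{..t}. \<omega> s \<in> S}
      \<in> sets (PiM J (\<lambda>_. count_space UNIV))"
  proof (intro sets.sets_Collect_finite_All)
    fix s assume "s \<in> {..t}"
    then have "s \<in> J" using assms(1) by auto
    have "{\<omega> \<in> space (PiM J (\<lambda>_. count_space UNIV)). \<omega> s \<in> S} =
        (\<lambda>\<omega>. \<omega> s) -` S \<inter> space (PiM J (\<lambda>_. count_space UNIV))" by auto
    then show "{\<omega> \<in> space (PiM J (\<lambda>_. count_space UNIV)). \<omega> s \<in> S}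
        \<in> sets (PiM J (\<lambda>_. count_space UNIV))"
      using measurable_sets[OF c[OF \<open>s \<in> J\<close>], of S] by simp
  qed simp
  then show "{\<omega> \<in> space (PiM J (\<lambda>_. count_space UNIV)). \<forall>s\<le>t. \<omega> s \<in> S}
      \<in> sets (PiM J (\<lambda>_. count_space UNIV))"
    by (simp only: atMost_iff Ball_def)
qed simp

lemma space_srw [simp]: "space (srw G u) = UNIV"
  and sets_srw [simp, measurable_cong]: "sets (srw G u) = sets (PiM UNIV (\<lambda>_. count_space UNIV))"
proof -
  interpret Ionescu_Tulcea "srw_kernel G u" "\<lambda>_. count_space UNIV" by (rule Ionescu_Tulcea_srw)
  show "space (srw G u) = UNIV" by (simp add: srw_def space_PiM)
  show "sets (srw G u) = sets (PiM UNIV (\<lambda>_. count_space UNIV))" by (simp add: srw_def)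
qed

lemma borel_measurable_stopped:
  fixes f :: "'a \<Rightarrow> ennreal"
  shows "(\<lambda>\<omega>. if \<forall>s\<le>t. \<omega> s \<in> S then f (\<omega> n) else 0) \<in> borel_measurable (srw G u)"
  using borel_measurable_stopped_PiM[of t UNIV n S f] by (simp cong: measurable_cong_sets)

lemma nn_integral_srw_0:
  fixes f :: "'a \<Rightarrow> ennreal"
  shows "(\<integral>\<^sup>+\<omega>. f (\<omega> 0) \<partial>srw G u) = f u"
proof -
  interpret Ionescu_Tulcea "srw_kernel G u" "\<lambda>_. count_space UNIV" by (rule Ionescu_Tulcea_srw)
  interpret prob_space PF.lim by (rule prob_space_lim)
  have "(\<lambda>\<omega>. \<omega> 0) \<in> measurable (PiM {0..<Suc 0} (\<lambda>_. count_space UNIV)) (count_space UNIV)"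
    by (intro measurable_component_singleton) auto
  then have "(\<lambda>\<omega>. f (\<omega> 0)) \<in> borel_measurable (PiM {0..<Suc 0} (\<lambda>_. count_space UNIV))"
    by (rule measurable_compose) auto
  from nn_integral_lim_Suc[OF this] show ?thesis
    using emeasure_space_1 by (simp add: srw_def srw_kernel_def nn_integral_return)
qed

lemma prob_space_srw: "prob_space (srw G u)"
proof
  show "emeasure (srw G u) (space (srw G u)) = 1"
    using nn_integral_srw_0[where f="\<lambda>_. 1" and G=G and u=u] by (simp only: nn_integral_const mult_1)
qed

text \<open>Markov property. The constraint concerns times up to \<open>t\<close> only, so it passes
  through the conditional expectation over the position at \<open>Suc t\<close>. Taking
  \<open>S = UNIV\<close> gives the free walk and \<open>S = - {v}\<close> the walk killed at
  \<open>v\<close>.\<close>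

lemma nn_integral_srw_Suc:
  fixes f :: "'a \<Rightarrow> ennreal"
  shows "(\<integral>\<^sup>+\<omega>. (if \<forall>s\<le>t. \<omega> s \<in> S then f (\<omega> (Suc t)) else 0) \<partial>srw G u) =
    (\<integral>\<^sup>+\<omega>. (if \<forall>s\<le>t. \<omega> s \<in> S then \<integral>\<^sup>+y. f y \<partial>pmf_of_set (neighbours G (\<omega> t)) else 0) \<partial>srw G u)"
proof -
  interpret Ionescu_Tulcea "srw_kernel G u" "\<lambda>_. count_space UNIV" by (rule Ionescu_Tulcea_srw)
  let ?F = "\<lambda>\<omega>. if \<forall>s\<le>t. \<omega> s \<in> S then f (\<omega> (Suc t)) else 0"
  have F: "?F \<in> borel_measurable (PiM {0..<Suc (Suc t)} (\<lambda>_. count_space UNIV))"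
    by (rule borel_measurable_stopped_PiM) auto
  have "(\<integral>\<^sup>+\<omega>. ?F \<omega> \<partial>srw G u) = (\<integral>\<^sup>+\<omega>. ?F (restrict \<omega> {0..<Suc (Suc t)}) \<partial>PF.lim)"
    unfolding srw_def by (intro nn_integral_cong) auto
  also have "\<dots> = (\<integral>\<^sup>+\<omega>. (\<integral>\<^sup>+x. ?F (fun_upd (restrict \<omega> {0..<Suc t}) (Suc t) x)
      \<partial>srw_kernel G u (Suc t) (restrict \<omega> {0..<Suc t})) \<partial>PF.lim)"
    by (rule nn_integral_lim_Suc[OF F])
  also have "\<dots> = (\<integral>\<^sup>+\<omega>. (if \<forall>s\<le>t. \<omega> s \<in> S then
      \<integral>\<^sup>+y. f y \<partial>pmf_of_set (neighbours G (\<omega> t)) else 0) \<partial>PF.lim)"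
  proof (intro nn_integral_cong)
    fix \<omega> :: "nat \<Rightarrow> 'a"
    have upd: "?F (fun_upd (restrict \<omega> {0..<Suc t}) (Suc t) x) = (if \<forall>s\<le>t. \<omega> s \<in> S then f x else 0)" for x
      by auto
    have kernel: "srw_kernel G u (Suc t) (restrict \<omega> {0..<Suc t}) = pmf_of_set (neighbours G (\<omega> t))"
      by (simp add: srw_kernel_def)
    have *: "(\<integral>\<^sup>+x. (if b then f x else 0) \<partial>pmf_of_set (neighbours G (\<omega> t))) =
        (if b then \<integral>\<^sup>+x. f x \<partial>pmf_of_set (neighbours G (\<omega> t)) else 0)" for b
      by (cases b) simp_all
    show "(\<integral>\<^sup>+x. ?F (fun_upd (restrict \<omega> {0..<Suc t}) (Suc t) x)
      \<partial>srw_kernel G u (Suc t) (restrict \<omega> {0..<Suc t})) = (if \<forall>s\<le>t. \<omega> s \<in> S then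
      \<integral>\<^sup>+y. f y \<partial>pmf_of_set (neighbours G (\<omega> t)) else 0)"
      unfolding upd kernel by (rule *)
  qed
  finally show ?thesis unfolding srw_def .
qed

section \<open>Hitting times from the one-step equations\<close>

lemma first_hit_conv_suminf:
  "first_hit v \<omega> = (\<Sum>t. if \<forall>s\<le>t. \<omega> s \<in> - {v} then 1 else 0)"
proof (cases "\<exists>t. \<omega> t = v")
  case True
  define T where "T = (LEAST t. \<omega> t = v)"
  have T: "\<omega> T = v" unfolding T_def using True by (rule LeastI_ex)
  have lt: "\<omega> s \<noteq> v" if "s < T" for s using that not_less_Least unfolding T_def by blast
  have "first_hit v \<omega> = of_nat T"
    unfolding first_hit_def
  proof (rule antisym)
    show "(INF t\<in>{t. \<omega> t = v}. of_nat t) \<le> (of_nat T :: ennreal)"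
      using T by (intro INF_lower) auto
    show "of_nat T \<le> (INF t\<in>{t. \<omega> t = v}. of_nat t :: ennreal)"
    proof (rule INF_greatest)
      fix t assume "t \<in> {t. \<omega> t = v}"
      then have "T \<le> t" unfolding T_def by (intro Least_le) simp
      then show "of_nat T \<le> (of_nat t :: ennreal)" by simp
    qed
  qed
  also have "of_nat T = (\<Sum>t<T. if \<forall>s\<le>t. \<omega> s \<in> - {v} then 1 else (0::ennreal))"
  proof -
    have "(\<Sum>t<T. if \<forall>s\<le>t. \<omega> s \<in> - {v} then 1 else (0::ennreal)) = (\<Sum>t<T. 1)"
      using lt by (intro sum.cong) auto
    then show ?thesis by simp
  qed
  also have "\<dots> = (\<Sum>t. if \<forall>s\<le>t. \<omega> s \<in> - {v} then 1 else 0)"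
    using T by (intro suminf_finite[symmetric]) (auto simp: not_less)
  finally show ?thesis .
next
  \<comment> \<open>A trajectory that avoids \<open>v\<close> has all summands equal to 1, so the
    sum is infinite, in agreement with the infimum over the empty set.\<close>
  case False
  then have e: "(\<lambda>t. if \<forall>s\<le>t. \<omega> s \<in> - {v} then 1 else (0::ennreal)) = (\<lambda>t. 1)" by auto
  have "(\<Sum>t. 1::ennreal) = top"
  proof (rule ccontr)
    assume "(\<Sum>t. 1::ennreal) \<noteq> top"
    then have "summable (\<lambda>t::nat. 1::real)"
      by (intro summable_suminf_not_top) auto
    then have "(\<lambda>_::nat. 1::real) \<longlonglongrightarrow> 0" by (rule summable_LIMSEQ_zero)
    then show False by (simp only: LIMSEQ_const_iff)
  qed
  with False show ?thesis by (simp add: first_hit_def e)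
qed

text \<open>The type of vertices may be larger than \<open>V\<close>, and \<open>pmf_of_set\<close>
  is uninformative on empty or infinite sets, so control is available only inside \<open>V\<close>.
  By induction on time, a walk that is almost surely in \<open>V\<close> has probability 0 of
  leaving it at the next step.\<close>

lemma AE_srw_in_closed_set:
  assumes "u \<in> V" and closed: "\<And>y. y \<in> V \<Longrightarrow> neighbours G y \<noteq> {}"
    "\<And>y. y \<in> V \<Longrightarrow> finite (neighbours G y)" "\<And>y. y \<in> V \<Longrightarrow> neighbours G y \<subseteq> V"
  shows "AE \<omega> in srw G u. \<omega> t \<in> V"
proof -
  have *: "(AE \<omega> in srw G u. \<omega> t \<in> V) \<longleftrightarrow> (\<integral>\<^sup>+\<omega>. indicator (- V) (\<omega> t) \<partial>srw G u) = 0" for t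
  proof -
    have "(\<lambda>\<omega>. indicator (- V) (\<omega> t) :: ennreal) \<in> borel_measurable (srw G u)"
      using borel_measurable_stopped[where t=t and S=UNIV and f="indicator (- V)" and n=t and G=G and u=u] by simp
    then have "(\<integral>\<^sup>+\<omega>. indicator (- V) (\<omega> t) \<partial>srw G u) = 0 \<longleftrightarrow>
        (AE \<omega> in srw G u. indicator (- V) (\<omega> t) = (0::ennreal))"
      by (rule nn_integral_0_iff_AE)
    then show ?thesis by (simp add: indicator_def)
  qed
  show ?thesis
  proof (induction t)
    case 0
    show ?case unfolding * using \<open>u \<in> V\<close> by (simp add: nn_integral_srw_0[where f="indicator (- V)"])
  next
    case (Suc t)
    have "(\<integral>\<^sup>+\<omega>. indicator (- V) (\<omega> (Suc t)) \<partial>srw G u) =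
        (\<integral>\<^sup>+\<omega>. \<integral>\<^sup>+y. indicator (- V) y \<partial>pmf_of_set (neighbours G (\<omega> t)) \<partial>srw G u)"
      using nn_integral_srw_Suc[where t=t and S=UNIV and f="indicator (- V)" and G=G and u=u] by simp
    also have "\<dots> = (\<integral>\<^sup>+\<omega>. 0 \<partial>srw G u)"
    proof (rule nn_integral_cong_AE, use Suc in eventually_elim)
      fix \<omega> assume "\<omega> t \<in> V"
      then have "AE y in pmf_of_set (neighbours G (\<omega> t)). y \<in> V"
        using closed by (auto simp: AE_measure_pmf_iff)
      then show "(\<integral>\<^sup>+y. indicator (- V) y \<partial>pmf_of_set (neighbours G (\<omega> t))) = 0"
        by (subst nn_integral_0_iff_AE) (auto simp: indicator_def)
    qed
    finally show ?case unfolding * by simp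
  qed
qed

lemma nn_integral_pmf_of_set_real:
  assumes "finite A" "A \<noteq> {}" "\<And>x. x \<in> A \<Longrightarrow> 0 \<le> g x"
  shows "(\<integral>\<^sup>+x. ennreal (g x) \<partial>pmf_of_set A) = ennreal ((\<Sum>x\<in>A. g x) / card A)"
  using assms
  by (simp add: nn_integral_pmf_of_set sum_ennreal card_gt_0_iff sum_nonneg
      ennreal_of_nat_eq_real_of_nat divide_ennreal)

text \<open>With \<open>p t\<close> the probability of not having hit \<open>v\<close> by time
  \<open>t\<close> and \<open>M t\<close> the expectation of \<open>g\<close> on that event, the
  one-step equation reads \<open>p t + M (Suc t) = M t\<close>. Telescoping gives \<open>g u\<close>
  as a partial sum of \<open>p\<close> plus \<open>M N\<close>, and the full sum of \<open>p\<close>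
  is the expected hitting time. It remains to see that \<open>M N\<close> vanishes in the
  limit.\<close>

theorem hitting_time_eqI:
  fixes g :: "'a \<Rightarrow> real"
  assumes V: "finite V" "u \<in> V" and closed: "\<And>y. y \<in> V \<Longrightarrow> neighbours G y \<noteq> {}"
    "\<And>y. y \<in> V \<Longrightarrow> neighbours G y \<subseteq> V"
    and nonneg: "\<And>y. y \<in> V \<Longrightarrow> 0 \<le> g y" and gv: "g v = 0"
    and step: "\<And>y. y \<in> V \<Longrightarrow> y \<noteq> v \<Longrightarrow>
      g y = 1 + (\<Sum>w\<in>neighbours G y. g w) / vertex_degree G y"
  shows "hitting_time G u v = ennreal (g u)"
proof -
  interpret prob_space "srw G u" by (rule prob_space_srw)
  have fin: "finite (neighbours G y)" if "y \<in> V" for y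
    using closed(2)[OF that] V(1) by (rule finite_subset)
  have AE_V: "AE \<omega> in srw G u. \<omega> t \<in> V" for t
    using V(2) closed(1) fin closed(2) by (rule AE_srw_in_closed_set)
  let ?alive = "\<lambda>t \<omega>. \<forall>s\<le>t. \<omega> s \<in> - {v}"
  define p where "p t = (\<integral>\<^sup>+\<omega>. (if ?alive t \<omega> then 1 else 0) \<partial>srw G u)" for t
  define M where "M t = (\<integral>\<^sup>+\<omega>. (if ?alive t \<omega> then ennreal (g (\<omega> t)) else 0) \<partial>srw G u)" for t
  have meas: "(\<lambda>\<omega>. if ?alive t \<omega> then f (\<omega> n) else 0) \<in> borel_measurable (srw G u)"
    for t n and f :: "'a \<Rightarrow> ennreal" by (rule borel_measurable_stopped)
  have M_0: "M 0 = ennreal (g u)"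
  proof -
    have "M 0 = (\<integral>\<^sup>+\<omega>. ennreal (g (\<omega> 0)) \<partial>srw G u)"
      unfolding M_def by (intro nn_integral_cong) (auto simp: gv)
    then show ?thesis by (simp add: nn_integral_srw_0[where f="\<lambda>x. ennreal (g x)"])
  qed
  have M_Suc: "p t + M (Suc t) = M t" for t
  proof -
    \<comment> \<open>Survival up to \<open>Suc t\<close> may be weakened to survival up to
      \<open>t\<close>, because \<open>g v = 0\<close>.\<close>
    have "M (Suc t) = (\<integral>\<^sup>+\<omega>. (if ?alive t \<omega> then ennreal (g (\<omega> (Suc t))) else 0) \<partial>srw G u)"
      unfolding M_def by (intro nn_integral_cong) (auto simp: gv le_Suc_eq)
    also have "\<dots> = (\<integral>\<^sup>+\<omega>. (if ?alive t \<omega> then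
        \<integral>\<^sup>+y. ennreal (g y) \<partial>pmf_of_set (neighbours G (\<omega> t)) else 0) \<partial>srw G u)"
      by (rule nn_integral_srw_Suc)
    finally have "p t + M (Suc t) = (\<integral>\<^sup>+\<omega>. (if ?alive t \<omega> then 1 else 0) + (if ?alive t \<omega> then
        \<integral>\<^sup>+y. ennreal (g y) \<partial>pmf_of_set (neighbours G (\<omega> t)) else 0) \<partial>srw G u)"
      unfolding p_def
      using meas[of t "\<lambda>_. 1"]
        meas[of t "\<lambda>x. \<integral>\<^sup>+y. ennreal (g y) \<partial>pmf_of_set (neighbours G x)"]
      by (simp add: nn_integral_add)
    also have "\<dots> = M t"
      unfolding M_def
    proof (rule nn_integral_cong_AE, use AE_V[of t] in eventually_elim)
      fix \<omega> assume V_t: "\<omega> t \<in> V"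
      show "(if ?alive t \<omega> then 1 else 0) + (if ?alive t \<omega> then
        \<integral>\<^sup>+y. ennreal (g y) \<partial>pmf_of_set (neighbours G (\<omega> t)) else 0)
        = (if ?alive t \<omega> then ennreal (g (\<omega> t)) else 0)"
      proof (cases "?alive t \<omega>")
        case True
        then have "\<omega> t \<noteq> v" by auto
        have nn: "0 \<le> g w" if "w \<in> neighbours G (\<omega> t)" for w
          using that closed(2)[OF V_t] nonneg by auto
        have "(\<integral>\<^sup>+y. ennreal (g y) \<partial>pmf_of_set (neighbours G (\<omega> t)))
            = ennreal ((\<Sum>w\<in>neighbours G (\<omega> t). g w) / vertex_degree G (\<omega> t))"
          unfolding vertex_degree_def
          using fin[OF V_t] closed(1)[OF V_t] nn by (rule nn_integral_pmf_of_set_real)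
        moreover have "0 \<le> (\<Sum>w\<in>neighbours G (\<omega> t). g w) / vertex_degree G (\<omega> t)"
          using nn by (intro divide_nonneg_nonneg sum_nonneg) auto
        ultimately show ?thesis
          using True step[OF V_t \<open>\<omega> t \<noteq> v\<close>] by simp
      qed auto
    qed
    finally show ?thesis .
  qed
  have sum_p: "(\<Sum>t<N. p t) + M N = ennreal (g u)" for N
  proof (induction N)
    case (Suc N)
    then show ?case using M_Suc[of N] by (simp add: add.assoc)
  qed (simp add: M_0)
  have hit: "hitting_time G u v = (\<Sum>t. p t)"
    unfolding hitting_time_def p_def first_hit_conv_suminf
    by (rule nn_integral_suminf) (rule meas[of _ "\<lambda>_. 1"])
  have p_lim: "p \<longlonglongrightarrow> 0"
  proof -
    have "p t \<le> 1" for t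
    proof -
      have "p t \<le> (\<integral>\<^sup>+\<omega>. 1 \<partial>srw G u)" unfolding p_def by (intro nn_integral_mono) auto
      then show ?thesis by (simp add: emeasure_space_1[simplified])
    qed
    \<comment> \<open>Finiteness of each \<open>p t\<close> lets the series be read over the reals,
      where the terms of a summable series tend to 0.\<close>
    then have p_real: "p t = ennreal (enn2real (p t))" for t
      by (rule ennreal_enn2real[OF le_less_trans[OF _ ennreal_one_less_top], symmetric])
    \<comment> \<open>The telescoped identity bounds every partial sum by \<open>g u\<close>; this
      makes \<open>v\<close> almost surely reached.\<close>
    have "(\<Sum>t. p t) \<le> ennreal (g u)"
    proof (rule suminf_le_const)
      show "(\<Sum>t<N. p t) \<le> ennreal (g u)" for N
        unfolding sum_p[of N, symmetric] by simp
    qed simp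
    then have "(\<Sum>t. ennreal (enn2real (p t))) \<noteq> top"
      by (simp only: p_real[symmetric]) (auto simp: top_unique)
    then have "summable (\<lambda>t. enn2real (p t))"
      by (intro summable_suminf_not_top) auto
    then have "(\<lambda>t. ennreal (enn2real (p t))) \<longlonglongrightarrow> ennreal 0"
      by (intro tendsto_ennrealI summable_LIMSEQ_zero)
    then show ?thesis by (simp only: p_real[symmetric] ennreal_0)
  qed
  have M_lim: "M \<longlonglongrightarrow> 0"
  proof -
    \<comment> \<open>Since \<open>V\<close> is finite, \<open>g\<close> is bounded on it, and
      \<open>M t\<close> is at most this bound times \<open>p t\<close>.\<close>
    define B where "B = Max (g ` V)"
    have B: "g y \<le> B" if "y \<in> V" for y
      using that V(1) unfolding B_def by auto
    have "M t \<le> ennreal B * p t" for t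
    proof -
      have "M t \<le> (\<integral>\<^sup>+\<omega>. ennreal B * (if ?alive t \<omega> then 1 else 0) \<partial>srw G u)"
        unfolding M_def
      proof (rule nn_integral_mono_AE, use AE_V[of t] in eventually_elim)
        fix \<omega> assume "\<omega> t \<in> V"
        then show "(if ?alive t \<omega> then ennreal (g (\<omega> t)) else 0)
            \<le> ennreal B * (if ?alive t \<omega> then 1 else 0)"
          using B by (auto intro: ennreal_leI)
      qed
      also have "\<dots> = ennreal B * p t"
        unfolding p_def using meas[of t "\<lambda>_. 1"] by (intro nn_integral_cmult) auto
      finally show ?thesis .
    qed
    moreover have "(\<lambda>t. ennreal B * p t) \<longlonglongrightarrow> 0"
      using ennreal_tendsto_cmult[OF _ p_lim, of "ennreal B"] by simp
    ultimately show ?thesis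
      by (intro tendsto_sandwich[OF _ _ tendsto_const, of 0 M sequentially "\<lambda>t. ennreal B * p t"]) auto
  qed
  have "(\<lambda>N. (\<Sum>t<N. p t) + M N) \<longlonglongrightarrow> (\<Sum>t. p t) + 0"
    by (rule tendsto_add[OF summable_LIMSEQ[OF summableI] M_lim])
  then show ?thesis
    unfolding sum_p hit by (simp add: LIMSEQ_const_iff)
qed

section \<open>Random walk on double stars\<close>

text \<open>Centres and leaf sets are arbitrary, so this covers both \<open>double_star\<close> on
  natural numbers and a double star found inside an abstract tree. The data are symmetric in the two
  centres, and \<open>swap\<close> turns each fact about \<open>a\<close> and \<open>L\<close> into
  one about \<open>b\<close> and \<open>R\<close>.\<close>

locale double_star_on =
  fixes G :: "'a pair_pre_digraph" and a b :: 'a and L R :: "'a set"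
  assumes finite_leaves: "finite L" "finite R" and nonempty_leaves: "L \<noteq> {}" "R \<noteq> {}"
    and centres: "a \<noteq> b" "a \<notin> L" "a \<notin> R" "b \<notin> L" "b \<notin> R" and disjoint_leaves: "L \<inter> R = {}"
    and pverts_eq: "pverts G = insert a (insert b (L \<union> R))"
    and parcs_eq: "parcs G = {(a, b), (b, a)} \<union> ({a} \<times> L \<union> L \<times> {a}) \<union> ({b} \<times> R \<union> R \<times> {b})"
begin

lemma swap: "double_star_on G b a R L"
  by unfold_locales
    (use finite_leaves nonempty_leaves centres disjoint_leaves pverts_eq parcs_eq in auto)

lemma neighbours_centre: "neighbours G a = insert b L"
  using centres by (auto simp: neighbours_def parcs_eq)

lemma neighbours_leaf: "x \<in> L \<Longrightarrow> neighbours G x = {a}"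
  using centres disjoint_leaves by (auto simp: neighbours_def parcs_eq)

lemmas neighbours_simps =
  neighbours_centre neighbours_leaf
  double_star_on.neighbours_centre[OF swap] double_star_on.neighbours_leaf[OF swap]

definition l where "l = real (card L)"
definition r where "r = real (card R)"

lemma vertex_degree_centre: "real (vertex_degree G a) = l + 1"
  and vertex_degree_leaf: "x \<in> L \<Longrightarrow> vertex_degree G x = 1"
  using finite_leaves centres by (auto simp: vertex_degree_def neighbours_simps l_def)

lemma card_pverts: "card (pverts G) = card L + card R + 2"
  using finite_leaves centres disjoint_leaves by (simp add: pverts_eq card_Un_disjoint)

lemma card_parcs: "card (parcs G) = 2 * (card L + card R + 1)"
proof -
  have "card ({a} \<times> L \<union> L \<times> {a}) = card L + card L"
    using finite_leaves centres by (subst card_Un_disjoint) (auto simp: card_cartesian_product)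
  moreover have "card ({b} \<times> R \<union> R \<times> {b}) = card R + card R"
    using finite_leaves centres by (subst card_Un_disjoint) (auto simp: card_cartesian_product)
  moreover have "card {(a, b), (b, a)} = 2"
    using centres by simp
  moreover have "card (parcs G) = card {(a, b), (b, a)} + card ({a} \<times> L \<union> L \<times> {a}) + card ({b} \<times> R \<union> R \<times> {b})"
    unfolding parcs_eq
    using finite_leaves centres disjoint_leaves by (subst card_Un_disjoint; (subst card_Un_disjoint)?) auto
  ultimately show ?thesis by simp
qed

lemma sum_pverts: "(\<Sum>v\<in>pverts G. f v) = f a + f b + (\<Sum>v\<in>L. f v) + (\<Sum>v\<in>R. f v)"
  for f :: "'a \<Rightarrow> 'b::comm_monoid_add"
  using finite_leaves centres disjoint_leaves
  by (simp add: pverts_eq sum.union_disjoint ac_simps)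

lemma l_ge_1: "l \<ge> 1" and r_ge_1: "r \<ge> 1"
  using finite_leaves nonempty_leaves by (auto simp: l_def r_def Suc_le_eq card_gt_0_iff)

lemma neighbours_closed:
  assumes "y \<in> pverts G" shows "neighbours G y \<noteq> {}" "neighbours G y \<subseteq> pverts G"
  using assms by (auto simp: pverts_eq neighbours_simps)

lemma finite_pverts: "finite (pverts G)"
  using finite_leaves by (simp add: pverts_eq)

text \<open>On a tree, crossing an edge takes 2k + 1 steps on average, where k is the number of
  edges behind the starting end once that edge is removed. For a target leaf \<open>w\<close> at
  \<open>a\<close>, this gives \<open>2 * (l + r) + 1\<close> from \<open>a\<close> to
  \<open>w\<close>, \<open>2 * r + 1\<close> from \<open>b\<close> to \<open>a\<close>, and 1 from
  any other leaf to its centre; the values are sums along paths.\<close>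

definition leaf_hit :: "'a \<Rightarrow> 'a \<Rightarrow> real" where
  "leaf_hit w u = (if u = w then 0 else if u = a then 2 * l + 2 * r + 1
      else if u \<in> L then 2 * (l + r + 1) else if u = b then 2 * (l + r + 1) + 2 * r
      else 2 * (l + r + 1) + 2 * r + 1)"

lemma leaf_hit_nonneg: "0 \<le> leaf_hit w u"
  using l_ge_1 r_ge_1 by (auto simp: leaf_hit_def)

lemma leaf_hit_centres:
  assumes "w \<in> L"
  shows "leaf_hit w a = 2 * l + 2 * r + 1" "leaf_hit w b = 2 * (l + r + 1) + 2 * r"
  using assms centres by (auto simp: leaf_hit_def)

lemma sum_leaf_hit:
  assumes w: "w \<in> L"
  shows "(\<Sum>x\<in>L. leaf_hit w x) = (l - 1) * (2 * (l + r + 1))"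
    and "(\<Sum>x\<in>R. leaf_hit w x) = r * (2 * (l + r + 1) + 2 * r + 1)"
proof -
  have "(\<Sum>x\<in>L. leaf_hit w x) = (\<Sum>x\<in>L - {w}. leaf_hit w x)"
    using w finite_leaves by (intro sum.mono_neutral_right) (auto simp: leaf_hit_def)
  also have "\<dots> = (\<Sum>x\<in>L - {w}. 2 * (l + r + 1))"
    using centres by (intro sum.cong) (auto simp: leaf_hit_def)
  also have "\<dots> = (l - 1) * (2 * (l + r + 1))"
    using w finite_leaves l_ge_1 by (simp add: l_def of_nat_diff)
  finally show "(\<Sum>x\<in>L. leaf_hit w x) = (l - 1) * (2 * (l + r + 1))" .
  have "(\<Sum>x\<in>R. leaf_hit w x) = (\<Sum>x\<in>R. 2 * (l + r + 1) + 2 * r + 1)"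
    using w centres disjoint_leaves by (intro sum.cong) (auto simp: leaf_hit_def)
  then show "(\<Sum>x\<in>R. leaf_hit w x) = r * (2 * (l + r + 1) + 2 * r + 1)" by (simp add: r_def)
qed

lemma hitting_time_leaf:
  assumes w: "w \<in> L" and u: "u \<in> pverts G"
  shows "hitting_time G u w = ennreal (leaf_hit w u)"
proof (rule hitting_time_eqI[OF finite_pverts u neighbours_closed])
  interpret S: double_star_on G b a R L by (rule swap)
  have S_lr: "S.l = r" "S.r = l" by (simp_all add: S.l_def S.r_def l_def r_def)
  show "0 \<le> leaf_hit w y" for y by (rule leaf_hit_nonneg)
  show "leaf_hit w w = 0" by (simp add: leaf_hit_def)
  fix y assume "y \<in> pverts G" "y \<noteq> w"
  then consider "y = a" | "y = b" | "y \<in> L" | "y \<in> R" by (auto simp: pverts_eq)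
  then show "leaf_hit w y = 1 + (\<Sum>x\<in>neighbours G y. leaf_hit w x) / vertex_degree G y"
  proof cases
    case 1
    have "(\<Sum>x\<in>neighbours G y. leaf_hit w x) = 2 * (l + r + 1) + 2 * r + (l - 1) * (2 * (l + r + 1))"
      unfolding 1 neighbours_centre sum.insert[OF finite_leaves(1) centres(4)] leaf_hit_centres(2)[OF w] sum_leaf_hit(1)[OF w] ..
    then show ?thesis
      unfolding 1 vertex_degree_centre leaf_hit_centres(1)[OF w] using l_ge_1 by (simp add: field_simps)
  next
    case 2
    have "(\<Sum>x\<in>neighbours G y. leaf_hit w x) = 2 * l + 2 * r + 1 + r * (2 * (l + r + 1) + 2 * r + 1)"
      unfolding 2 S.neighbours_centre sum.insert[OF finite_leaves(2) centres(3)] leaf_hit_centres(1)[OF w] sum_leaf_hit(2)[OF w] ..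
    then show ?thesis
      unfolding 2 S.vertex_degree_centre leaf_hit_centres(2)[OF w] S_lr using r_ge_1 by (simp add: field_simps)
  next
    case 3
    then have "leaf_hit w y = 2 * (l + r + 1)" using \<open>y \<noteq> w\<close> centres by (auto simp: leaf_hit_def)
    moreover have "(\<Sum>x\<in>neighbours G y. leaf_hit w x) = leaf_hit w a" using 3 by (simp only: neighbours_leaf) simp
    ultimately show ?thesis unfolding vertex_degree_leaf[OF 3] leaf_hit_centres(1)[OF w] by simp
  next
    case 4
    then have "leaf_hit w y = 2 * (l + r + 1) + 2 * r + 1" using w centres disjoint_leaves by (auto simp: leaf_hit_def)
    moreover have "(\<Sum>x\<in>neighbours G y. leaf_hit w x) = leaf_hit w b" using 4 by (simp only: S.neighbours_leaf) simp
    ultimately show ?thesis unfolding S.vertex_degree_leaf[OF 4] leaf_hit_centres(2)[OF w] by simp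
  qed
qed

text \<open>The same edge-crossing rule for target \<open>a\<close>: there are \<open>r\<close>
  edges behind \<open>b\<close>, hence \<open>2 * r + 1\<close>, and a leaf adds one step.\<close>

definition centre_hit :: "'a \<Rightarrow> real" where
  "centre_hit u = (if u = a then 0 else if u \<in> L then 1 else if u = b then 2 * r + 1 else 2 * r + 2)"

lemma centre_hit_nonneg: "0 \<le> centre_hit u"
  using r_ge_1 by (auto simp: centre_hit_def)

lemma centre_hit_centres: "centre_hit a = 0" "centre_hit b = 2 * r + 1"
  using centres by (auto simp: centre_hit_def)

lemma sum_centre_hit:
  "(\<Sum>x\<in>L. centre_hit x) = l" "(\<Sum>x\<in>R. centre_hit x) = r * (2 * r + 2)"
proof -
  have "(\<Sum>x\<in>L. centre_hit x) = (\<Sum>x\<in>L. 1)"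
    using centres by (intro sum.cong) (auto simp: centre_hit_def)
  then show "(\<Sum>x\<in>L. centre_hit x) = l" by (simp add: l_def)
  have "(\<Sum>x\<in>R. centre_hit x) = (\<Sum>x\<in>R. 2 * r + 2)"
    using centres disjoint_leaves by (intro sum.cong) (auto simp: centre_hit_def)
  then show "(\<Sum>x\<in>R. centre_hit x) = r * (2 * r + 2)" by (simp add: r_def)
qed

lemma hitting_time_centre:
  assumes u: "u \<in> pverts G"
  shows "hitting_time G u a = ennreal (centre_hit u)"
proof (rule hitting_time_eqI[OF finite_pverts u neighbours_closed])
  interpret S: double_star_on G b a R L by (rule swap)
  have S_lr: "S.l = r" "S.r = l" by (simp_all add: S.l_def S.r_def l_def r_def)
  show "0 \<le> centre_hit y" for y by (rule centre_hit_nonneg)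
  show "centre_hit a = 0" by (rule centre_hit_centres)
  fix y assume "y \<in> pverts G" "y \<noteq> a"
  then consider "y = b" | "y \<in> L" | "y \<in> R" by (auto simp: pverts_eq)
  then show "centre_hit y = 1 + (\<Sum>x\<in>neighbours G y. centre_hit x) / vertex_degree G y"
  proof cases
    case 1
    have "(\<Sum>x\<in>neighbours G y. centre_hit x) = 0 + r * (2 * r + 2)"
      unfolding 1 S.neighbours_centre sum.insert[OF finite_leaves(2) centres(3)] sum_centre_hit(2) centre_hit_centres(1) ..
    then show ?thesis
      unfolding 1 S.vertex_degree_centre centre_hit_centres(2) S_lr using r_ge_1 by (simp add: field_simps)
  next
    case 2
    then have "centre_hit y = 1" using centres by (auto simp: centre_hit_def)
    moreover have "(\<Sum>x\<in>neighbours G y. centre_hit x) = centre_hit a" using 2 by (simp only: neighbours_leaf) simp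
    ultimately show ?thesis by (simp add: centre_hit_centres)
  next
    case 3
    then have "centre_hit y = 2 * r + 2" using centres disjoint_leaves by (auto simp: centre_hit_def)
    moreover have "(\<Sum>x\<in>neighbours G y. centre_hit x) = centre_hit b" using 3 by (simp only: S.neighbours_leaf) simp
    ultimately show ?thesis unfolding S.vertex_degree_leaf[OF 3] centre_hit_centres(2) by simp
  qed
qed

text \<open>The stationary weights are the degrees \<open>l + 1\<close>, \<open>r + 1\<close> and 1
  over twice the number of edges, \<open>2 * (l + r + 1)\<close>. Nonnegativity of \<open>g\<close>
  allows the whole sum to be computed over the reals.\<close>

lemma stationary_hitting_time_eq_sum:
  assumes "\<And>v. v \<in> pverts G \<Longrightarrow> hitting_time G v w = ennreal (g v)"
    and "\<And>v. v \<in> pverts G \<Longrightarrow> 0 \<le> g v"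
  shows "stationary_hitting_time G w =
    ennreal (((l + 1) * g a + (r + 1) * g b + (\<Sum>v\<in>L. g v) + (\<Sum>v\<in>R. g v)) / (2 * (l + r + 1)))"
proof -
  interpret S: double_star_on G b a R L by (rule swap)
  have S_lr: "S.l = r" "S.r = l" by (simp_all add: S.l_def S.r_def l_def r_def)
  have "stationary_hitting_time G w = (\<Sum>v\<in>pverts G. ennreal (stationary G v * g v))"
    unfolding stationary_hitting_time_def using assms
    by (intro sum.cong) (auto simp: ennreal_mult[symmetric] stationary_def)
  also have "\<dots> = ennreal (\<Sum>v\<in>pverts G. stationary G v * g v)"
    using assms(2) by (intro sum_ennreal) (auto simp: stationary_def)
  also have "(\<Sum>v\<in>pverts G. stationary G v * g v) = (\<Sum>v\<in>pverts G. vertex_degree G v * g v) / (2 * (l + r + 1))"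
    by (simp add: stationary_def card_parcs sum_divide_distrib l_def r_def algebra_simps)
  also have "(\<Sum>v\<in>pverts G. vertex_degree G v * g v) =
      (l + 1) * g a + (r + 1) * g b + (\<Sum>v\<in>L. g v) + (\<Sum>v\<in>R. g v)"
    unfolding sum_pverts by (simp add: vertex_degree_centre S.vertex_degree_centre
        vertex_degree_leaf S.vertex_degree_leaf S_lr)
  finally show ?thesis .
qed

text \<open>The numerator is arranged so that, apart from the term \<open>4 * r * (r + 1)\<close>,
  it depends only on \<open>l + r\<close>, which is fixed by the number of vertices.\<close>

lemma stationary_hitting_time_leaf:
  assumes w: "w \<in> L"
  shows "stationary_hitting_time G w = ennreal
    (((2 * (l + r) + 1)\<^sup>2 + (l + r) + 4 * r * (r + 1)) / (2 * (l + r + 1)))"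
proof -
  have "(l + 1) * leaf_hit w a + (r + 1) * leaf_hit w b + (\<Sum>v\<in>L. leaf_hit w v) + (\<Sum>v\<in>R. leaf_hit w v) =
      (2 * (l + r) + 1)\<^sup>2 + (l + r) + 4 * r * (r + 1)"
    unfolding leaf_hit_centres[OF w] sum_leaf_hit[OF w] by (simp add: algebra_simps power2_eq_square)
  then show ?thesis
    using stationary_hitting_time_eq_sum[OF hitting_time_leaf[OF w] leaf_hit_nonneg] by simp
qed

lemma stationary_hitting_time_centre:
  "stationary_hitting_time G a = ennreal ((l + r + 4 * r * (r + 1) + 1) / (2 * (l + r + 1)))"
proof -
  have "(l + 1) * centre_hit a + (r + 1) * centre_hit b + (\<Sum>v\<in>L. centre_hit v) + (\<Sum>v\<in>R. centre_hit v) =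
      l + r + 4 * r * (r + 1) + 1"
    unfolding centre_hit_centres sum_centre_hit by (simp add: algebra_simps)
  then show ?thesis
    using stationary_hitting_time_eq_sum[OF hitting_time_centre centre_hit_nonneg] by simp
qed

end

section \<open>The meeting time of a double star in closed form\<close>

text \<open>This is the value at a leaf after substituting \<open>l + r = n - 2\<close>;
  \<open>k\<close> counts the leaves at the centre that is not adjacent to the target.\<close>

definition double_star_meet :: "nat \<Rightarrow> nat \<Rightarrow> real" where
  "double_star_meet n k =
    ((2 * real n - 3)\<^sup>2 + (real n - 2) + 4 * real k * (real k + 1)) / (2 * (real n - 1))"

lemma double_star_meet_less_iff:
  assumes "n \<ge> 2" shows "double_star_meet n j < double_star_meet n k \<longleftrightarrow> j < k"
proof -
  have mono: "double_star_meet n j < double_star_meet n k" if "j < k" for j k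
  proof -
    have "real j * (real j + 1) < real k * (real k + 1)"
      using that by (intro mult_strict_mono) auto
    then show ?thesis
      using assms by (simp add: double_star_meet_def divide_less_cancel)
  qed
  show ?thesis
    using mono[of j k] mono[of k j] by (cases j k rule: linorder_cases) auto
qed

lemma double_star_meet_nonneg: "n \<ge> 2 \<Longrightarrow> 0 \<le> double_star_meet n k"
  by (simp add: double_star_meet_def)

context double_star_on
begin

lemma stationary_hitting_time_leaf_meet:
  assumes "w \<in> L"
  shows "stationary_hitting_time G w = ennreal (double_star_meet (card (pverts G)) (card R))"
proof -
  have "2 * real (card (pverts G)) - 3 = 2 * (l + r) + 1" "real (card (pverts G)) - 2 = l + r"
    "2 * (real (card (pverts G)) - 1) = 2 * (l + r + 1)"
    by (simp_all add: card_pverts l_def r_def)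
  then show ?thesis
    unfolding stationary_hitting_time_leaf[OF assms] double_star_meet_def r_def[symmetric] by (simp only:)
qed

text \<open>The fractions for \<open>a\<close> and for a leaf at \<open>a\<close> have the same
  denominator, and their numerators differ by the square of \<open>2 * (l + r) + 1\<close> minus
  1.\<close>

lemma stationary_hitting_time_centre_le:
  "stationary_hitting_time G a \<le> ennreal (double_star_meet (card (pverts G)) (card R))"
proof -
  have *: "2 * real (card (pverts G)) - 3 = 2 * (l + r) + 1" "real (card (pverts G)) - 2 = l + r"
    "2 * (real (card (pverts G)) - 1) = 2 * (l + r + 1)"
    by (simp_all add: card_pverts l_def r_def)
  have "1 \<le> (2 * (l + r) + 1)\<^sup>2"
    using l_ge_1 r_ge_1 by (intro one_le_power) auto
  then show ?thesis
    unfolding stationary_hitting_time_centre double_star_meet_def r_def[symmetric] *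
    using l_ge_1 r_ge_1 by (intro ennreal_leI divide_right_mono) auto
qed

lemma T_meet_eq:
  "T_meet G = ennreal (double_star_meet (card (pverts G)) (max (card L) (card R)))"
  unfolding T_meet_def
proof (rule Max_eqI)
  interpret S: double_star_on G b a R L by (rule swap)
  have n: "card (pverts G) \<ge> 2" by (simp add: card_pverts)
  have mono: "double_star_meet (card (pverts G)) j \<le> double_star_meet (card (pverts G)) k"
    if "j \<le> k" for j k
    using that double_star_meet_less_iff[OF n, of k j] by auto
  show "finite (stationary_hitting_time G ` pverts G)"
    using finite_pverts by simp
  fix y assume "y \<in> stationary_hitting_time G ` pverts G"
  then obtain w where w: "w \<in> pverts G" "y = stationary_hitting_time G w" by auto
  have "y \<le> ennreal (double_star_meet (card (pverts G)) (card L)) \<or>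
      y \<le> ennreal (double_star_meet (card (pverts G)) (card R))"
    using w stationary_hitting_time_leaf_meet S.stationary_hitting_time_leaf_meet
      stationary_hitting_time_centre_le S.stationary_hitting_time_centre_le
    by (auto simp: pverts_eq)
  then show "y \<le> ennreal (double_star_meet (card (pverts G)) (max (card L) (card R)))"
    using mono[of "card L" "max (card L) (card R)"] mono[of "card R" "max (card L) (card R)"]
    by (auto intro: order_trans ennreal_leI)
next
  interpret S: double_star_on G b a R L by (rule swap)
  obtain x y where "x \<in> L" "y \<in> R" using nonempty_leaves by auto
  \<comment> \<open>The worst target is a leaf at the centre with fewer leaves, since its value
    increases with the number of leaves at the opposite centre.\<close>
  then have "stationary_hitting_time G (if card L \<le> card R then x else y) =
      ennreal (double_star_meet (card (pverts G)) (max (card L) (card R)))"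
    using stationary_hitting_time_leaf_meet[of x] S.stationary_hitting_time_leaf_meet[of y]
    by (auto simp: max_def)
  then show "ennreal (double_star_meet (card (pverts G)) (max (card L) (card R)))
      \<in> stationary_hitting_time G ` pverts G"
    using \<open>x \<in> L\<close> \<open>y \<in> R\<close>
    by (intro image_eqI[of _ _ "if card L \<le> card R then x else y"]) (auto simp: pverts_eq)
qed

end

section \<open>Double stars as trees of diameter 3\<close>

lemma relpow_2_iff: "(u, v) \<in> E ^^ 2 \<longleftrightarrow> (\<exists>x. (u, x) \<in> E \<and> (x, v) \<in> E)"
  unfolding numeral_2_eq_2 relpow.simps by blast

lemma relpow_3_iff: "(u, v) \<in> E ^^ 3 \<longleftrightarrow> (\<exists>x y. (u, x) \<in> E \<and> (x, y) \<in> E \<and> (y, v) \<in> E)"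
  unfolding numeral_3_eq_3 relpow.simps by blast

lemma relpow_le_2_iff:
  "(\<exists>j\<le>2. (u, v) \<in> E ^^ j) \<longleftrightarrow> u = v \<or> (u, v) \<in> E \<or> (\<exists>x. (u, x) \<in> E \<and> (x, v) \<in> E)"
proof -
  have "(\<exists>j\<le>2. (u, v) \<in> E ^^ j) \<longleftrightarrow> (u, v) \<in> E ^^ 0 \<or> (u, v) \<in> E ^^ 1 \<or> (u, v) \<in> E ^^ 2"
    by (auto simp only: numeral_2_eq_2 le_Suc_eq le_0_eq One_nat_def)
  then show ?thesis unfolding relpow_2_iff by simp
qed

lemma relpow_le_3_iff:
  "(\<exists>j\<le>3. (u, v) \<in> E ^^ j) \<longleftrightarrow> u = v \<or> (u, v) \<in> E \<or> (\<exists>x. (u, x) \<in> E \<and> (x, v) \<in> E) \<or>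
     (\<exists>x y. (u, x) \<in> E \<and> (x, y) \<in> E \<and> (y, v) \<in> E)"
proof -
  have "(\<exists>j\<le>3. (u, v) \<in> E ^^ j) \<longleftrightarrow> (\<exists>j\<le>2. (u, v) \<in> E ^^ j) \<or> (u, v) \<in> E ^^ 3"
    by (auto simp only: numeral_2_eq_2 numeral_3_eq_3 le_Suc_eq)
  then show ?thesis unfolding relpow_3_iff relpow_le_2_iff by simp
qed

text \<open>Translates walks into relation powers, for which short distances become plain
  first-order statements. The start must be a vertex because the empty walk exists only there,
  whereas the zeroth power is the full identity.\<close>

lemma ex_awalk_length_iff:
  assumes "pair_wf_digraph G" "u \<in> pverts G"
  shows "(\<exists>p. pre_digraph.awalk (with_proj G) u p v \<and> length p = k) \<longleftrightarrow> (u, v) \<in> parcs G ^^ k"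
  using assms(2)
proof (induction k arbitrary: u)
  interpret pair_wf_digraph G by fact
  case 0
  then show ?case by (auto simp: awalk_Nil_iff)
next
  interpret pair_wf_digraph G by fact
  case (Suc k)
  show ?case
  proof
    assume "\<exists>p. awalk u p v \<and> length p = Suc k"
    then obtain p where p: "awalk u p v" "length p = Suc k" by blast
    then obtain w p' where w: "(u, w) \<in> parcs G" "awalk w p' v" "length p' = k"
      by (cases p) (auto simp: awalk_Cons_iff)
    then have "(w, v) \<in> parcs G ^^ k"
      using Suc.IH[of w] wellformed'(2)[OF w(1)] by blast
    with w(1) show "(u, v) \<in> parcs G ^^ Suc k" by (rule relpow_Suc_I2)
  next
    assume "(u, v) \<in> parcs G ^^ Suc k"
    then obtain w where w: "(u, w) \<in> parcs G" "(w, v) \<in> parcs G ^^ k"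
      by (rule relpow_Suc_E2)
    then obtain p where "awalk w p v" "length p = k"
      using Suc.IH[of w] wellformed'(2)[OF w(1)] by blast
    with w(1) have "awalk u ((u, w) # p) v" "length ((u, w) # p) = Suc k"
      by (auto simp: awalk_Cons_iff)
    then show "\<exists>p. awalk u p v \<and> length p = Suc k" by blast
  qed
qed

lemma graph_dist_conv_INF:
  assumes "pair_wf_digraph G"
  shows "graph_dist G u v = (INF p\<in>{p. pre_digraph.awalk (with_proj G) u p v}. ereal (real (length p)))"
proof -
  interpret pair_wf_digraph G by fact
  have "awalk_cost (\<lambda>_. 1) p = real (length p)" for p
    by (induction p) auto
  then show ?thesis by (simp add: graph_dist_def \<mu>_def)
qed

lemma graph_dist_leI:
  assumes "pair_wf_digraph G" "u \<in> pverts G" "\<exists>j\<le>k. (u, v) \<in> parcs G ^^ j"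
  shows "graph_dist G u v \<le> ereal (real k)"
proof -
  obtain j where "j \<le> k" "(u, v) \<in> parcs G ^^ j" using assms(3) by blast
  from ex_awalk_length_iff[OF assms(1,2), THEN iffD2, OF this(2)]
  obtain p where p: "pre_digraph.awalk (with_proj G) u p v" "length p = j" by blast
  then have "graph_dist G u v \<le> ereal (real (length p))"
    unfolding graph_dist_conv_INF[OF assms(1)] by (intro INF_lower) simp
  with p(2) \<open>j \<le> k\<close> show ?thesis by (simp add: order_trans)
qed

lemma graph_dist_geI:
  assumes "pair_wf_digraph G" "u \<in> pverts G" "\<not> (\<exists>j\<le>k. (u, v) \<in> parcs G ^^ j)"
  shows "graph_dist G u v \<ge> ereal (real (Suc k))"
  unfolding graph_dist_conv_INF[OF assms(1)]
proof (rule INF_greatest)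
  fix p assume "p \<in> {p. pre_digraph.awalk (with_proj G) u p v}"
  then have "(u, v) \<in> parcs G ^^ length p"
    by (intro ex_awalk_length_iff[OF assms(1,2), THEN iffD1]) blast
  then have "\<not> length p \<le> k" using assms(3) by blast
  then show "ereal (real (Suc k)) \<le> ereal (real (length p))" by simp
qed

lemma graph_dist_le_graph_diameter:
  assumes "u \<in> pverts G" "v \<in> pverts G"
  shows "graph_dist G u v \<le> graph_diameter G"
proof -
  have "graph_dist G u v \<le> (SUP v\<in>pverts G. graph_dist G u v)"
    using assms(2) by (rule SUP_upper)
  also have "\<dots> \<le> graph_diameter G"
    unfolding graph_diameter_def using assms(1) by (rule SUP_upper)
  finally show ?thesis .
qed

text \<open>Distances are natural numbers or infinite: a pair without a walk of length at most 3
  would be at distance at least 4, and if every pair had a walk of length at most 2, the supremum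
  would be at most 2.\<close>

lemma graph_diameter_eq_3D:
  assumes "pair_wf_digraph G" "graph_diameter G = 3"
  shows "\<And>u v. u \<in> pverts G \<Longrightarrow> v \<in> pverts G \<Longrightarrow> \<exists>j\<le>3. (u, v) \<in> parcs G ^^ j"
    and "\<exists>u\<in>pverts G. \<exists>v\<in>pverts G. \<not> (\<exists>j\<le>2. (u, v) \<in> parcs G ^^ j)"
proof -
  fix u v assume uv: "u \<in> pverts G" "v \<in> pverts G"
  have "\<not> ereal (real (Suc 3)) \<le> graph_dist G u v"
  proof
    assume "ereal (real (Suc 3)) \<le> graph_dist G u v"
    also have "\<dots> \<le> 3" using graph_dist_le_graph_diameter[OF uv] assms(2) by simp
    finally show False by simp
  qed
  then show "\<exists>j\<le>3. (u, v) \<in> parcs G ^^ j"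
    using graph_dist_geI[OF assms(1) uv(1), of 3 v] by blast
next
  show "\<exists>u\<in>pverts G. \<exists>v\<in>pverts G. \<not> (\<exists>j\<le>2. (u, v) \<in> parcs G ^^ j)"
  proof (rule ccontr)
    assume "\<not> ?thesis"
    then have "graph_dist G u v \<le> ereal (real 2)" if "u \<in> pverts G" "v \<in> pverts G" for u v
      using that by (intro graph_dist_leI[OF assms(1)]) auto
    then have "graph_diameter G \<le> ereal (real 2)"
      unfolding graph_diameter_def by (intro SUP_least)
    then show False using assms(2) by simp
  qed
qed

lemma graph_diameter_eq_3I:
  assumes "pair_wf_digraph G"
    and "\<And>u v. u \<in> pverts G \<Longrightarrow> v \<in> pverts G \<Longrightarrow> \<exists>j\<le>3. (u, v) \<in> parcs G ^^ j"
    and "u \<in> pverts G" "v \<in> pverts G" "\<not> (\<exists>j\<le>2. (u, v) \<in> parcs G ^^ j)"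
  shows "graph_diameter G = 3"
proof (rule antisym)
  have "graph_diameter G \<le> ereal (real 3)"
    unfolding graph_diameter_def
    by (intro SUP_least graph_dist_leI[OF assms(1)] assms(2))
  then show "graph_diameter G \<le> 3" by simp
  have "3 = ereal (real (Suc 2))" by simp
  also have "\<dots> \<le> graph_dist G u v" by (rule graph_dist_geI[OF assms(1,3,5)])
  also have "\<dots> \<le> graph_diameter G"
    using assms(3,4) by (rule graph_dist_le_graph_diameter)
  finally show "3 \<le> graph_diameter G" .
qed

section \<open>Cycles given by lists of vertices\<close>

lemma pawalk_verts_vwalk_arcs: "pawalk_verts x (vwalk_arcs (x # xs)) = x # xs"
  by (induction xs arbitrary: x) auto

lemma pcas_vwalk_arcs: "pcas x (vwalk_arcs (x # xs)) (last (x # xs))"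
  by (induction xs arbitrary: x) auto

lemma length_vwalk_arcs: "length (vwalk_arcs xs) = length xs - 1"
  by (induction xs rule: vwalk_arcs.induct) auto

text \<open>Closing the vertex list produces a directed cycle with \<open>length xs + 1\<close>
  arcs, hence at least 3, which rules out the back-and-forth walk along one edge.\<close>

lemma tree_no_cycle:
  assumes "is_tree G" "distinct (x # xs)" "length xs \<ge> 2"
  shows "\<not> set (vwalk_arcs (x # xs @ [x])) \<subseteq> parcs G"
proof
  assume sub: "set (vwalk_arcs (x # xs @ [x])) \<subseteq> parcs G"
  interpret pair_graph G using assms(1) by (simp add: is_tree_def)
  let ?p = "vwalk_arcs (x # xs @ [x])"
  obtain y ys where xs: "xs = y # ys" using assms(3) by (cases xs) auto
  have "x \<in> pverts G" using sub by (auto simp: xs intro: wellformed')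
  then have "awalk x ?p x"
    using sub pcas_vwalk_arcs[of x "xs @ [x]"] by (simp add: awalk_def)
  moreover have "distinct (tl (pawalk_verts x ?p))"
    using assms(2) by (simp only: pawalk_verts_vwalk_arcs list.sel) auto
  moreover have "length ?p \<ge> 3" using assms(3) by (simp add: length_vwalk_arcs)
  moreover from this have "?p \<noteq> []" by auto
  ultimately show False
    using assms(1) unfolding is_tree_def cycle_def by blast
qed

section \<open>Double stars are trees of diameter 3\<close>

context double_star_on
begin

lemma leaf_arc: "(y, x) \<in> parcs G \<Longrightarrow> y \<noteq> a \<Longrightarrow> y \<noteq> b \<Longrightarrow> (y, z) \<in> parcs G \<Longrightarrow> x = z"
  using centres disjoint_leaves by (auto simp: parcs_eq)

lemma sym_parcs: "(x, y) \<in> parcs G \<Longrightarrow> (y, x) \<in> parcs G"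
  by (auto simp: parcs_eq)

lemma pair_graph: "pair_graph G"
proof
  show "finite (pverts G)" by (rule finite_pverts)
  show "finite (parcs G)" using finite_leaves by (simp add: parcs_eq)
  show "symmetric (with_proj G)"
    unfolding symmetric_def by (auto intro: symI sym_parcs)
qed (use centres in \<open>auto simp: parcs_eq pverts_eq\<close>)

sublocale pair_graph G by (rule pair_graph)

text \<open>Every vertex is a centre or adjacent to one, and the centres are adjacent.\<close>

lemma relpow_le_3:
  assumes "u \<in> pverts G" "v \<in> pverts G"
  shows "\<exists>j\<le>3. (u, v) \<in> parcs G ^^ j"
proof -
  have near: "\<exists>p. (p = a \<or> p = b) \<and> (x = p \<or> (x, p) \<in> parcs G)" if "x \<in> pverts G" for x
    using that unfolding pverts_eq parcs_eq by blast
  obtain p q where pq: "p = a \<or> p = b" "u = p \<or> (u, p) \<in> parcs G"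
    "q = a \<or> q = b" "v = q \<or> (q, v) \<in> parcs G"
    using near[OF assms(1)] near[OF assms(2)] sym_parcs by blast
  then have "p = q \<or> (p, q) \<in> parcs G" by (auto simp: parcs_eq)
  with pq(2,4) show ?thesis unfolding relpow_le_3_iff by blast
qed

text \<open>On a cycle with at least three arcs, the predecessor and the successor of a vertex
  differ, so by \<open>leaf_arc\<close> the vertex is a centre. Three consecutive distinct vertices
  would then have to be among two centres.\<close>

lemma no_long_cycle:
  assumes "cycle p" shows "length p < 3"
proof (rule ccontr)
  assume "\<not> length p < 3"
  obtain u where u: "awalk u p u" "distinct (tl (pawalk_verts u p))"
    using assms unfolding cycle_def by blast
  obtain e1 e2 e3 q where p: "p = e1 # e2 # e3 # q"
    using \<open>\<not> length p < 3\<close>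
    by (cases p; cases "tl p"; cases "tl (tl p)") (auto simp: not_less)
  define y z w where "y = snd e1" and "z = snd e2" and "w = snd e3"
  have e: "e1 = (u, y)" "e2 = (y, z)" "e3 = (z, w)" and q: "awalk w q u"
    using u(1) by (auto simp: p awalk_Cons_iff y_def z_def w_def prod_eq_iff)
  have arcs: "(u, y) \<in> parcs G" "(y, z) \<in> parcs G" "(z, w) \<in> parcs G"
    using u(1) by (auto simp: p e awalk_Cons_iff)
  have d: "distinct (y # z # pawalk_verts w q)"
    using u(2) by (simp add: p e)
  have "w \<in> set (pawalk_verts w q)" "u \<in> set (pawalk_verts w q)"
    using q hd_in_awalk_verts(1)[OF q] last_in_set[of "pawalk_verts w q"]
    by (auto elim!: awalkE)
  then have ne: "u \<noteq> y" "u \<noteq> z" "w \<noteq> y" "w \<noteq> z" "y \<noteq> z"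
    using d by auto
  have "y = a \<or> y = b"
    using leaf_arc[OF sym_parcs[OF arcs(1)] _ _ arcs(2)] ne by blast
  moreover have "z = a \<or> z = b"
    using leaf_arc[OF sym_parcs[OF arcs(2)] _ _ arcs(3)] ne by blast
  \<comment> \<open>The successor of \<open>w\<close> is \<open>y\<close> if the cycle has exactly
    three arcs, and the head of the fourth arc otherwise; in both cases it differs from
    \<open>z\<close>.\<close>
  moreover have "w = a \<or> w = b"
  proof (cases q)
    case Nil
    then have "w = u" using q by (simp add: awalk_Nil_iff)
    then show ?thesis
      using leaf_arc[OF sym_parcs[OF arcs(3)] _ _ arcs(1)[folded \<open>w = u\<close>]] ne by blast
  next
    case (Cons e q')
    then have "(w, snd e) \<in> parcs G" and q': "awalk (snd e) q' u"
      using q by (cases e; auto simp: awalk_Cons_iff)+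
    moreover have "snd e \<noteq> z"
      using d hd_in_awalk_verts(1)[OF q'] by (auto simp: Cons)
    ultimately show ?thesis
      using leaf_arc[OF sym_parcs[OF arcs(3)]] by blast
  qed
  ultimately show False using ne by auto
qed

lemma is_tree: "is_tree G"
proof -
  let ?R = "rtrancl_on (pverts G) ((parcs G)\<^sup>s)"
  have arc: "(x, y) \<in> ?R" if "(x, y) \<in> parcs G" for x y
    using that wellformed'
    by (intro rtrancl_on_into_rtrancl_on[OF rtrancl_on_refl]) (auto simp: symcl_def)
  have "(a, b) \<in> parcs G" "(b, a) \<in> parcs G"
    "\<And>x. x \<in> L \<Longrightarrow> (a, x) \<in> parcs G" "\<And>x. x \<in> L \<Longrightarrow> (x, a) \<in> parcs G"
    "\<And>x. x \<in> R \<Longrightarrow> (b, x) \<in> parcs G" "\<And>x. x \<in> R \<Longrightarrow> (x, b) \<in> parcs G"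
    by (auto simp: parcs_eq)
  note R = this[THEN arc]
  have to_a: "(u, a) \<in> ?R" if "u \<in> pverts G" for u
    using that R rtrancl_on_trans[OF R(6) R(2), of u] rtrancl_on_refl[of a "pverts G" "(parcs G)\<^sup>s"]
    unfolding pverts_eq by blast
  have from_a: "(a, u) \<in> ?R" if "u \<in> pverts G" for u
    using that R rtrancl_on_trans[OF R(1) R(5), of u] rtrancl_on_refl[of a "pverts G" "(parcs G)\<^sup>s"]
    unfolding pverts_eq by blast
  have "Digraph_Component.connected (with_proj G)"
    unfolding connected_conv using rtrancl_on_trans[OF to_a from_a]
    by (auto simp: pverts_eq)
  then show ?thesis
    using no_long_cycle pair_graph unfolding is_tree_def by (meson not_less)
qed

lemma graph_diameter: "graph_diameter G = 3"
proof -
  obtain x y where xy: "x \<in> L" "y \<in> R" using nonempty_leaves by auto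
  show ?thesis
  proof (rule graph_diameter_eq_3I)
    show "pair_wf_digraph G" by unfold_locales
    show "x \<in> pverts G" "y \<in> pverts G" using xy by (auto simp: pverts_eq)
    show "\<not> (\<exists>j\<le>2. (x, y) \<in> parcs G ^^ j)"
      unfolding relpow_le_2_iff using xy centres disjoint_leaves by (auto simp: parcs_eq)
  qed (rule relpow_le_3)
qed

end

section \<open>Trees of diameter 3 are double stars\<close>

lemma tree_no_short_cycle:
  assumes "is_tree G"
  shows "\<lbrakk>(p, q) \<in> parcs G; (q, r) \<in> parcs G; (r, p) \<in> parcs G\<rbrakk> \<Longrightarrow> False"
    and "\<lbrakk>(p, q) \<in> parcs G; (q, r) \<in> parcs G; (r, s) \<in> parcs G; (s, p) \<in> parcs G;
      p \<noteq> r; q \<noteq> s\<rbrakk> \<Longrightarrow> False"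
proof -
  interpret pair_graph G using assms(1) by (simp add: is_tree_def)
  have irrefl: "x \<noteq> y" if "(x, y) \<in> parcs G" for x y using pair_no_loops[OF that] by simp
  show False if "(p, q) \<in> parcs G" "(q, r) \<in> parcs G" "(r, p) \<in> parcs G"
    using tree_no_cycle[OF assms, of p "[q, r]"] that irrefl by auto
  show False if "(p, q) \<in> parcs G" "(q, r) \<in> parcs G" "(r, s) \<in> parcs G" "(s, p) \<in> parcs G"
    "p \<noteq> r" "q \<noteq> s"
    using tree_no_cycle[OF assms, of p "[q, r, s]"] that irrefl by auto
qed

text \<open>A walk of length at most 3 between the ends of the path \<open>w, x, a, b, v\<close>
  closes a cycle. Chords of the path are excluded first, which confines how the short walk can meet
  the path.\<close>

lemma tree_no_shortcut:
  assumes tree: "is_tree G"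
    and path: "(w, x) \<in> parcs G" "(x, a) \<in> parcs G" "(a, b) \<in> parcs G" "(b, v) \<in> parcs G"
    and w: "w \<noteq> a" "w \<noteq> b" "(w, a) \<notin> parcs G" "(w, b) \<notin> parcs G" and xb: "x \<noteq> b" and va: "v \<noteq> a"
  shows "\<not> (\<exists>j\<le>3. (w, v) \<in> parcs G ^^ j)"
proof
  interpret pair_graph G using tree by (simp add: is_tree_def)
  have irrefl: "p \<noteq> q" if "(p, q) \<in> parcs G" for p q using pair_no_loops[OF that] by simp
  have sym: "(q, p) \<in> parcs G" if "(p, q) \<in> parcs G" for p q
    using pair_sym_arcs that by (auto simp: symmetric_def dest: symD)
  note no_triangle = tree_no_short_cycle(1)[OF tree]
  note no_square = tree_no_short_cycle(2)[OF tree]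
  have wv: "w \<noteq> v" using path(4) w(4) sym by blast
  have xv: "x \<noteq> v" using no_triangle[OF path(2,3)] path(4) by blast
  have dist5: "distinct [w, x, a, b, v]"
    using w xb va wv xv path[THEN irrefl] by auto
  have x_v: "(x, v) \<notin> parcs G"
    using no_square[OF path(2-4)] sym xb va by blast
  have a_v: "(a, v) \<notin> parcs G"
    using no_triangle[OF path(3,4)] sym by blast
  have x_b: "(x, b) \<notin> parcs G"
    using no_triangle[OF path(2,3)] sym by blast
  have w_v: "(w, v) \<notin> parcs G"
    using tree_no_cycle[OF tree, of w "[x, a, b, v]"] dist5 path sym by auto
  assume "\<exists>j\<le>3. (w, v) \<in> parcs G ^^ j"
  with wv w_v consider p where "(w, p) \<in> parcs G" "(p, v) \<in> parcs G"
    | p q where "(w, p) \<in> parcs G" "(p, q) \<in> parcs G" "(q, v) \<in> parcs G"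
    unfolding relpow_le_3_iff by blast
  then show False
  proof cases
    case 1
    then have "p \<notin> {w, x, a, b, v}" using w x_v w_v irrefl by auto
    then show False
      using tree_no_cycle[OF tree, of w "[x, a, b, v, p]"] dist5 path sym 1 by auto
  next
    case 2
    have p: "p \<notin> {w, a, b, v}" using 2(1) w w_v irrefl by auto
    have q: "q \<notin> {x, a, w, v}" using 2(3) x_v a_v w_v irrefl by auto
    \<comment> \<open>If \<open>p = x\<close>, the walk shares the first arc of the path and the
      cycle is formed from \<open>x\<close> on; if \<open>q = b\<close>, it shares the last arc and
      the cycle stops at \<open>b\<close>. Otherwise all seven vertices are distinct.\<close>
    show False
    proof (cases "p = x")
      case True
      then have "q \<noteq> b" using 2(2) x_b by auto
      then show False
        using tree_no_cycle[OF tree, of x "[a, b, v, q]"] dist5 path sym 2 q True by auto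
    next
      case px: False
      show False
      proof (cases "q = b")
        case True
        then show False
          using tree_no_cycle[OF tree, of w "[x, a, b, p]"] dist5 path sym 2 p px by auto
      next
        case False
        then show False
          using tree_no_cycle[OF tree, of w "[x, a, b, v, q, p]"] dist5 path sym 2 p q px
            irrefl[OF 2(2)] by auto
      qed
    qed
  qed
qed

lemma tree_diameter_3_double_star:
  assumes tree: "is_tree G" and diam: "graph_diameter G = 3"
  obtains a b L R where "double_star_on G a b L R"
proof -
  interpret pair_graph G using tree by (simp add: is_tree_def)
  have irrefl: "p \<noteq> q" if "(p, q) \<in> parcs G" for p q using pair_no_loops[OF that] by simp
  have sym: "(q, p) \<in> parcs G" if "(p, q) \<in> parcs G" for p q
    using pair_sym_arcs that by (auto simp: symmetric_def dest: symD)
  note no_triangle = tree_no_short_cycle(1)[OF tree]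
  note no_square = tree_no_short_cycle(2)[OF tree]
  have wf: "pair_wf_digraph G" by unfold_locales
  note le_3 = graph_diameter_eq_3D(1)[OF wf diam]
  obtain u v where uv: "u \<in> pverts G" "v \<in> pverts G" "\<not> (\<exists>j\<le>2. (u, v) \<in> parcs G ^^ j)"
    using graph_diameter_eq_3D(2)[OF wf diam] by blast
  from uv(3) have not2: "u \<noteq> v" "(u, v) \<notin> parcs G" "\<And>x. (u, x) \<in> parcs G \<Longrightarrow> (x, v) \<notin> parcs G"
    unfolding relpow_le_2_iff by blast+
  from le_3[OF uv(1,2)] not2
  obtain a b where ab: "(u, a) \<in> parcs G" "(a, b) \<in> parcs G" "(b, v) \<in> parcs G"
    unfolding relpow_le_3_iff by blast
  have ub: "u \<noteq> b" and va: "v \<noteq> a" using ab not2 by blast+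
  \<comment> \<open>\<open>S\<close> is the closed neighbourhood of the two centres. It is closed
    under arcs, and everything is reachable from \<open>a\<close>, so it contains all
    vertices.\<close>
  define S where "S = {x. x = a \<or> x = b \<or> (x, a) \<in> parcs G \<or> (x, b) \<in> parcs G}"
  have S_step: "w \<in> S" if x: "x \<in> S" "(x, w) \<in> parcs G" for x w
  proof (rule ccontr)
    assume "w \<notin> S"
    then have w: "w \<noteq> a" "w \<noteq> b" "(w, a) \<notin> parcs G" "(w, b) \<notin> parcs G" by (auto simp: S_def)
    then have "x \<noteq> a" "x \<noteq> b" using x(2) sym by blast+
    with x(1) consider "(x, a) \<in> parcs G" | "(x, b) \<in> parcs G" by (auto simp: S_def)
    \<comment> \<open>A vertex \<open>w\<close> outside \<open>S\<close> but adjacent to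
      \<open>x\<close> extends one of the paths \<open>x, a, b, v\<close> and
      \<open>x, b, a, u\<close>, according to the centre adjacent to \<open>x\<close>.\<close>
    then show False
    proof cases
      case 1
      show False
        using tree_no_shortcut[OF tree sym[OF x(2)] 1 ab(2,3) w \<open>x \<noteq> b\<close> va]
          le_3[OF wellformed'(2)[OF x(2)] uv(2)] by contradiction
    next
      case 2
      show False
        using tree_no_shortcut[OF tree sym[OF x(2)] 2 sym[OF ab(2)] sym[OF ab(1)] w(2,1,4,3) \<open>x \<noteq> a\<close> ub]
          le_3[OF wellformed'(2)[OF x(2)] uv(1)] by contradiction
    qed
  qed
  have "(a, w) \<in> parcs G ^^ j \<Longrightarrow> w \<in> S" for w j
  proof (induction j arbitrary: w)
    case 0
    then show ?case by (simp add: S_def)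
  next
    case (Suc j)
    from Suc.prems obtain x where "(a, x) \<in> parcs G ^^ j" "(x, w) \<in> parcs G"
      by (rule relpow_Suc_E)
    then show ?case using Suc.IH S_step by blast
  qed
  then have pverts_S: "pverts G \<subseteq> S"
    using le_3[OF wellformed'(1)[OF ab(2)]] by blast
  define L where "L = {x. (x, a) \<in> parcs G \<and> x \<noteq> b}"
  define R where "R = {x. (x, b) \<in> parcs G \<and> x \<noteq> a}"
  have LR_verts: "L \<subseteq> pverts G" "R \<subseteq> pverts G"
    using wellformed' by (auto simp: L_def R_def)
  have "double_star_on G a b L R"
  proof
    show "finite L" "finite R"
      using LR_verts pair_finite_verts by (auto intro: finite_subset)
    \<comment> \<open>The end points \<open>u\<close> and \<open>v\<close> of the diametral path are
      the witnesses.\<close>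
    show "L \<noteq> {}" "R \<noteq> {}"
      using ab ub va sym by (auto simp: L_def R_def)
    show "a \<noteq> b" "a \<notin> L" "a \<notin> R" "b \<notin> L" "b \<notin> R"
      using ab(2) irrefl by (auto simp: L_def R_def)
    show "L \<inter> R = {}"
      using no_triangle[OF _ sym[OF ab(2)]] sym by (auto simp: L_def R_def)
    show "pverts G = insert a (insert b (L \<union> R))"
    proof
      show "pverts G \<subseteq> insert a (insert b (L \<union> R))"
        using pverts_S by (auto simp: S_def L_def R_def)
      show "insert a (insert b (L \<union> R)) \<subseteq> pverts G"
        using LR_verts wellformed'[OF ab(2)] by blast
    qed
    \<comment> \<open>Any further arc would join two non-central vertices, each adjacent to a
      centre: a common centre gives a triangle, different centres give a square.\<close>
    have "(x, y) \<in> {(a, b), (b, a)} \<union> ({a} \<times> L \<union> L \<times> {a}) \<union> ({b} \<times> R \<union> R \<times> {b})"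
      if xy: "(x, y) \<in> parcs G" for x y
    proof (rule ccontr)
      assume not: "\<not> ?thesis"
      have "x \<in> S" "y \<in> S" using pverts_S wellformed'[OF xy] by blast+
      moreover have "x \<noteq> a" "x \<noteq> b" "y \<noteq> a" "y \<noteq> b"
        using not xy sym[OF xy] irrefl[OF xy] by (auto simp: L_def R_def)
      ultimately consider "(x, a) \<in> parcs G" "(y, a) \<in> parcs G" | "(x, b) \<in> parcs G" "(y, b) \<in> parcs G"
        | "(x, a) \<in> parcs G" "(y, b) \<in> parcs G" | "(x, b) \<in> parcs G" "(y, a) \<in> parcs G"
        by (auto simp: S_def)
      then show False
      proof cases
        case 1
        then show False using no_triangle[OF xy] sym by blast
      next
        case 2
        then show False using no_triangle[OF xy] sym by blast
      next
        case 3
        then show False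
          using no_square[OF xy 3(2) sym[OF ab(2)] sym[OF 3(1)]] \<open>x \<noteq> b\<close> \<open>y \<noteq> a\<close> by blast
      next
        case 4
        then show False
          using no_square[OF xy 4(2) ab(2) sym[OF 4(1)]] \<open>x \<noteq> a\<close> \<open>y \<noteq> b\<close> by blast
      qed
    qed
    moreover have "{(a, b), (b, a)} \<union> ({a} \<times> L \<union> L \<times> {a}) \<union> ({b} \<times> R \<union> R \<times> {b}) \<subseteq> parcs G"
      using ab(2) sym by (auto simp: L_def R_def)
    ultimately show "parcs G = {(a, b), (b, a)} \<union> ({a} \<times> L \<union> L \<times> {a}) \<union> ({b} \<times> R \<union> R \<times> {b})"
      by (intro subset_antisym subrelI) blast+
  qed
  then show thesis by (rule that)
qed

section \<open>Isomorphism and minimality\<close>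

lemma double_star_on_iso:
  assumes G: "double_star_on G a b L R" and H: "double_star_on H a' b' L' R'"
    and card: "card L = card L'" "card R = card R'"
  shows "digraph_iso (with_proj G) (with_proj H)"
proof -
  interpret G: double_star_on G a b L R by fact
  interpret H: double_star_on H a' b' L' R' by fact
  obtain g where g: "bij_betw g L L'"
    using finite_same_card_bij[OF G.finite_leaves(1) H.finite_leaves(1) card(1)] by blast
  obtain h where h: "bij_betw h R R'"
    using finite_same_card_bij[OF G.finite_leaves(2) H.finite_leaves(2) card(2)] by blast
  define f where "f x = (if x = a then a' else if x = b then b' else if x \<in> L then g x else h x)" for x
  have f: "f a = a'" "f b = b'" "\<And>x. x \<in> L \<Longrightarrow> f x = g x" "\<And>x. x \<in> R \<Longrightarrow> f x = h x"
    using G.centres G.disjoint_leaves by (auto simp: f_def)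
  have img: "f ` L = L'" "f ` R = R'"
    using f(3,4) bij_betw_imp_surj_on[OF g] bij_betw_imp_surj_on[OF h] by (auto simp: image_iff)
  \<comment> \<open>\<open>f\<close> maps onto the vertices of \<open>H\<close>, of which there are
    equally many, so it is injective.\<close>
  have inj: "inj_on f (pverts G)"
  proof (rule eq_card_imp_inj_on[OF G.finite_pverts])
    have "f ` pverts G = pverts H"
      by (simp add: G.pverts_eq H.pverts_eq f(1,2) image_Un img)
    then show "card (f ` pverts G) = card (pverts G)"
      by (simp add: G.card_pverts H.card_pverts card)
  qed
  let ?hom = "\<lparr>iso_verts = f, iso_arcs = map_prod f f, iso_head = snd, iso_tail = fst\<rparr>"
  have "inj_on (map_prod f f) (parcs G)"
  proof (rule inj_on_subset)
    show "inj_on (map_prod f f) (pverts G \<times> pverts G)"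
      using inj by (auto simp: inj_on_def)
    show "parcs G \<subseteq> pverts G \<times> pverts G"
      using G.wellformed' by auto
  qed
  then have "pre_digraph.digraph_isomorphism (with_proj G) ?hom"
    using inj G.wf_digraph_axioms by (auto simp: pre_digraph.digraph_isomorphism_def)
  moreover have "with_proj H = app_iso ?hom (with_proj G)"
  proof -
    have "map_prod f f ` parcs G = parcs H"
      unfolding G.parcs_eq H.parcs_eq image_Un map_prod_image
      by (simp add: map_prod_image[symmetric] f(1,2) img map_prod_surj_on)
    then show ?thesis
      by (simp add: app_iso_def with_proj_def G.pverts_eq H.pverts_eq f(1,2) image_Un img)
  qed
  ultimately show ?thesis unfolding digraph_iso_def by blast
qed

lemma digraph_iso_double_star_on:
  assumes iso: "digraph_iso (with_proj G) (with_proj H)" and G: "double_star_on G a b L R"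
  obtains f where "inj_on f (pverts G)" "double_star_on H (f a) (f b) (f ` L) (f ` R)"
proof -
  interpret G: double_star_on G a b L R by fact
  obtain hom where hom: "pre_digraph.digraph_isomorphism (with_proj G) hom"
    and H: "with_proj H = app_iso hom (with_proj G)"
    using iso unfolding digraph_iso_def by blast
  let ?f = "iso_verts hom"
  have inj: "inj_on ?f (pverts G)"
    using hom by (simp add: pre_digraph.digraph_isomorphism_def)
  have tail: "iso_tail hom = fst" and head: "iso_head hom = snd"
    and verts: "pverts H = ?f ` pverts G" and arcs: "parcs H = iso_arcs hom ` parcs G"
    using H by (simp_all add: app_iso_def with_proj_def)
  \<comment> \<open>Arcs are pairs with tail \<open>fst\<close> and head \<open>snd\<close> on both
    sides, so the vertex map determines the arc map.\<close>
  have "iso_arcs hom e = map_prod ?f ?f e" if "e \<in> parcs G" for e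
    using hom that by (auto simp: pre_digraph.digraph_isomorphism_def tail head prod_eq_iff)
  then have arcs': "parcs H = map_prod ?f ?f ` parcs G"
    unfolding arcs by (intro image_cong) auto
  have sub: "a \<in> pverts G" "b \<in> pverts G" "L \<subseteq> pverts G" "R \<subseteq> pverts G"
    by (auto simp: G.pverts_eq)
  have "double_star_on H (?f a) (?f b) (?f ` L) (?f ` R)"
  proof
    show "finite (?f ` L)" "finite (?f ` R)" "?f ` L \<noteq> {}" "?f ` R \<noteq> {}"
      using G.finite_leaves G.nonempty_leaves by auto
    show "?f a \<noteq> ?f b" using G.centres sub inj_onD[OF inj] by blast
    show "?f a \<notin> ?f ` L" "?f a \<notin> ?f ` R" "?f b \<notin> ?f ` L" "?f b \<notin> ?f ` R"
      using G.centres sub by (simp_all add: inj_on_image_mem_iff[OF inj])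
    show "?f ` L \<inter> ?f ` R = {}"
      using G.disjoint_leaves sub by (simp add: inj_on_image_Int[OF inj, symmetric])
    show "pverts H = insert (?f a) (insert (?f b) (?f ` L \<union> ?f ` R))"
      by (simp add: verts G.pverts_eq image_Un)
    show "parcs H = {(?f a, ?f b), (?f b, ?f a)} \<union> ({?f a} \<times> ?f ` L \<union> ?f ` L \<times> {?f a}) \<union>
        ({?f b} \<times> ?f ` R \<union> ?f ` R \<times> {?f b})"
      unfolding arcs' G.parcs_eq image_Un by (simp add: map_prod_surj_on)
  qed
  with inj show thesis by (rule that)
qed

text \<open>Invariance is read off from the closed form: the image is again a double star with the
  same leaf counts, so the random walk itself is not transported.\<close>

lemma digraph_iso_T_meet_eq:
  assumes iso: "digraph_iso (with_proj G) (with_proj H)" and G: "double_star_on G a b L R"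
  shows "T_meet G = T_meet H"
proof -
  interpret G: double_star_on G a b L R by fact
  obtain f where inj: "inj_on f (pverts G)" and "double_star_on H (f a) (f b) (f ` L) (f ` R)"
    using digraph_iso_double_star_on[OF iso G] .
  then interpret H: double_star_on H "f a" "f b" "f ` L" "f ` R" by simp
  have "inj_on f L" "inj_on f R"
    using inj by (auto simp: G.pverts_eq intro: inj_on_subset)
  then show ?thesis
    by (simp add: G.T_meet_eq H.T_meet_eq G.card_pverts H.card_pverts card_image)
qed

section \<open>The balanced double star and its value\<close>

lemma double_star_on_double_star:
  assumes "l \<ge> 1" "r \<ge> 1"
  shows "double_star_on (double_star l r) 0 1 {2..<l + 2} {l + 2..<l + r + 2}"
proof
  show "pverts (double_star l r) = insert 0 (insert 1 ({2..<l + 2} \<union> {l + 2..<l + r + 2}))"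
    by (auto simp: double_star_def)
qed (use assms in \<open>auto simp: double_star_def\<close>)

lemma balanced_double_star_eq:
  assumes "n \<ge> 2"
  shows "balanced_double_star n = double_star ((n - 2) div 2) ((n - 1) div 2)"
proof -
  have real: "(real n - 2) / 2 = real (n - 2) / real 2" using assms by (simp add: of_nat_diff)
  have "nat \<lfloor>(real n - 2) / 2\<rfloor> = (n - 2) div 2"
    unfolding real floor_divide_of_nat_eq by simp
  moreover have "nat \<lceil>(real n - 2) / 2\<rceil> = (n - 1) div 2"
  proof (cases "even n")
    case True
    then obtain k where "n = 2 * k" by blast
    then show ?thesis by (cases k) auto
  next
    case False
    then obtain k where k: "n = 2 * k + 1" by (rule oddE)
    have "\<lceil>(real n - 2) / 2\<rceil> = int k"
      by (intro ceiling_unique) (auto simp: k field_simps)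
    then show ?thesis by (simp add: k)
  qed
  ultimately show ?thesis by (simp add: balanced_double_star_def)
qed

text \<open>For even \<open>n\<close> the numerator is \<open>(5 * n - 8) * (n - 1) - 1\<close>,
  which leaves the extra fraction; for odd \<open>n\<close> it is
  \<open>(5 * n - 6) * (n - 1)\<close>, and the division is exact.\<close>

lemma double_star_meet_balanced:
  assumes "n \<ge> 2"
  shows "even n \<Longrightarrow> double_star_meet n ((n - 1) div 2) = 5 / 2 * real n - 4 - 1 / (2 * (real n - 1))"
    and "odd n \<Longrightarrow> double_star_meet n ((n - 1) div 2) = 5 / 2 * real n - 3"
proof -
  have n: "real n - 1 \<noteq> 0" using assms by auto
  show "double_star_meet n ((n - 1) div 2) = 5 / 2 * real n - 4 - 1 / (2 * (real n - 1))" if "even n"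
  proof -
    have "2 * ((n - 1) div 2) + 2 = n" using that assms by presburger
    then have "real (2 * ((n - 1) div 2) + 2) = real n" by (rule arg_cong)
    then have k: "real ((n - 1) div 2) = (real n - 2) / 2" by simp
    have eq: "4 * real ((n - 1) div 2) * (real ((n - 1) div 2) + 1) = (real n - 2) * real n"
      unfolding k by (simp add: field_simps)
    then show ?thesis
      unfolding double_star_meet_def eq using n by (simp add: field_simps power2_eq_square)
  qed
  show "double_star_meet n ((n - 1) div 2) = 5 / 2 * real n - 3" if "odd n"
  proof -
    have "2 * ((n - 1) div 2) + 1 = n" using that assms by presburger
    then have "real (2 * ((n - 1) div 2) + 1) = real n" by (rule arg_cong)
    then have k: "real ((n - 1) div 2) = (real n - 1) / 2" by simp
    have eq: "4 * real ((n - 1) div 2) * (real ((n - 1) div 2) + 1) = (real n - 1) * (real n + 1)"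
      unfolding k by (simp add: field_simps)
    then show ?thesis
      unfolding double_star_meet_def eq using n by (simp add: field_simps power2_eq_square)
  qed
qed

theorem theorem1p6:
  fixes n :: nat
  assumes "n \<ge> 4"
  shows
    "(is_tree (balanced_double_star n) \<and> card (pverts (balanced_double_star n)) = n \<and>
      graph_diameter (balanced_double_star n) = 3) \<and>
     (\<forall>G :: 'a pair_pre_digraph.
        is_tree G \<and> card (pverts G) = n \<and> graph_diameter G = 3 \<longrightarrow>
          T_meet (balanced_double_star n) \<le> T_meet G \<and>
          (T_meet G = T_meet (balanced_double_star n) \<longleftrightarrow>
             digraph_iso (with_proj G) (with_proj (balanced_double_star n)))) \<and>
     (even n \<longrightarrow>
        T_meet (balanced_double_star n) =
          ennreal (5 / 2 * real n - 4 - 1 / (2 * (real n - 1))) \<and>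
        (\<forall>v0. v0 \<in> neighbours (balanced_double_star n) 0 \<and>
              vertex_degree (balanced_double_star n) v0 = 1 \<longrightarrow>
           stationary_hitting_time (balanced_double_star n) v0 =
             ennreal (5 / 2 * real n - 4 - 1 / (2 * (real n - 1))))) \<and>
     (odd n \<longrightarrow>
        T_meet (balanced_double_star n) = ennreal (5 / 2 * real n - 3) \<and>
        (\<forall>v0. v0 \<in> neighbours (balanced_double_star n) 0 \<and>
              vertex_degree (balanced_double_star n) v0 = 1 \<longrightarrow>
           stationary_hitting_time (balanced_double_star n) v0 =
             ennreal (5 / 2 * real n - 3)))"
proof -
  let ?D = "balanced_double_star n"
  let ?l = "(n - 2) div 2" and ?r = "(n - 1) div 2"
  have D: "?D = double_star ?l ?r" using assms by (intro balanced_double_star_eq) simp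
  have lr: "?l \<ge> 1" "?r \<ge> 1" "?l \<le> ?r" "?l + ?r + 2 = n" using assms by presburger+
  interpret D: double_star_on ?D 0 1 "{2..<?l + 2}" "{?l + 2..<?l + ?r + 2}"
    unfolding D by (rule double_star_on_double_star[OF lr(1,2)])
  have n: "n \<ge> 2" using assms by simp
  have card_D: "card (pverts ?D) = n" 
    unfolding D.card_pverts card_atLeastLessThan using lr(4) by linarith
  have T_D: "T_meet ?D = ennreal (double_star_meet n ?r)"
    unfolding D.T_meet_eq card_D using lr(3) by (simp add: max_absorb2)
  have leaf: "stationary_hitting_time ?D v0 = ennreal (double_star_meet n ?r)"
    if "v0 \<in> neighbours ?D 0" "vertex_degree ?D v0 = 1" for v0
  proof -
    \<comment> \<open>The only neighbour of centre 0 that is not a leaf is centre 1, and the degree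
      condition excludes it because its degree is at least 2.\<close>
    have "real (vertex_degree ?D 1) = real ?r + 1"
      using double_star_on.vertex_degree_centre[OF D.swap]
      unfolding double_star_on.l_def[OF D.swap] card_atLeastLessThan by linarith
    with that(2) lr(2) have "v0 \<noteq> 1" by auto
    then have "v0 \<in> {2..<?l + 2}" using that(1) by (simp add: D.neighbours_centre)
    then show ?thesis by (simp add: D.stationary_hitting_time_leaf_meet card_D)
  qed
  have min: "T_meet ?D \<le> T_meet G \<and> (T_meet G = T_meet ?D \<longleftrightarrow> digraph_iso (with_proj G) (with_proj ?D))"
    if G: "is_tree G" "card (pverts G) = n" "graph_diameter G = 3" for G :: "'a pair_pre_digraph"
  proof -
    obtain a b L R where G_star: "double_star_on G a b L R"
      using tree_diameter_3_double_star[OF G(1,3)] .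
    then interpret G: double_star_on G a b L R .
    have card_LR: "card L + card R + 2 = n" using G(2) by (simp add: G.card_pverts)
    have T_G: "T_meet G = ennreal (double_star_meet n (max (card L) (card R)))"
      by (simp add: G.T_meet_eq G(2))
    \<comment> \<open>The larger of two numbers with sum \<open>n - 2\<close> is at least half of
      it, rounded up.\<close>
    have r_le: "?r \<le> max (card L) (card R)" using card_LR by linarith
    have le: "double_star_meet n ?r \<le> double_star_meet n (max (card L) (card R))"
      using r_le double_star_meet_less_iff[OF n] by (meson not_le)
    have "digraph_iso (with_proj G) (with_proj ?D)" if eq: "T_meet G = T_meet ?D"
    proof -
      \<comment> \<open>Both values are nonnegative, so equality descends to the reals; strict
        monotonicity then determines the larger leaf count, and the vertex count the smaller
        one.\<close>
      have "double_star_meet n (max (card L) (card R)) = double_star_meet n ?r"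
        using eq double_star_meet_nonneg[OF n] by (simp add: T_G T_D)
      then have "\<not> ?r < max (card L) (card R)"
        using double_star_meet_less_iff[OF n] by (metis less_irrefl)
      with r_le have "max (card L) (card R) = ?r" by simp
      then consider "card L = ?l" "card R = ?r" | "card L = ?r" "card R = ?l"
        using card_LR lr(4) by (auto simp: max_def split: if_splits)
      then show ?thesis
      proof cases
        case 1
        then show ?thesis by (intro double_star_on_iso[OF G_star D.double_star_on_axioms]) simp_all
      next
        \<comment> \<open>Here the larger leaf set is at \<open>a\<close>, so the roles of the
          centres are exchanged.\<close>
        case 2
        then show ?thesis by (intro double_star_on_iso[OF G.swap D.double_star_on_axioms]) simp_all
      qed
    qed
    moreover have "T_meet G = T_meet ?D" if "digraph_iso (with_proj G) (with_proj ?D)"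
      using that G_star by (rule digraph_iso_T_meet_eq)
    ultimately show ?thesis using le by (auto simp: T_G T_D intro: ennreal_leI)
  qed
  show ?thesis
    using D.is_tree card_D D.graph_diameter min leaf T_D double_star_meet_balanced[OF n] by simp
qed

end
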